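(* Let $d\geqslant 2$, let $V=\{(n_1,\ldots,n_d)\in\mathbb{Z}^d : \gcd(n_1,\ldots,n_d)=1\}=\mathbb{Z}^d\setminus\bigcup_{p}(p\,\mathbb{Z}^d)$ (union over all rational primes $p$) be the set of visible points of $\mathbb{Z}^d$, and consider the topological dynamical system $(\mathbb{X}_V,\mathbb{Z}^d)$ with $\mathbb{X}_V=\overline{\mathbb{Z}^d+V}$. Then $\mathbb{X}_V$ has topological entropy $\log(2)/\zeta(d)$ and satisfies $\mathbb{X}_V=\mathbb{A}$, where $\mathbb{A}$ consists of all admissible subsets of $\mathbb{Z}^d$, that is, all subsets $U\subset\mathbb{Z}^d$ such that, for every rational prime $p$, $U$ misses at least one coset modulo $p\,\mathbb{Z}^d$. Moreover, the symmetry group (topological centraliser) of this system is $\mathcal{S}(\mathbb{X}_V)=\mathbb{Z}^d$, while its extended symmetry group (topological normaliser) is $\mathcal{R}(\mathbb{X}_V)=\mathbb{Z}^d\rtimes\mathrm{GL}(d,\mathbb{Z})$.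
   Context: Subsets $U\subseteq\mathbb{Z}^d$ are identified with configurations $x=1_U\in\{0,1\}^{\mathbb{Z}^d}$, with the product topology (local topology). $\overline{\mathbb{Z}^d+V}$ denotes the closure of $\{t+V : t\in\mathbb{Z}^d\}$ in this topology. $\mathbb{Z}^d$ acts by shifts $T_t$, $(T_t x)_n=x_{n+t}$, i.e. $T_t(U)=U-t$. $\zeta$ is Riemann's zeta function. For a subshift $\mathbb{X}$ (closed, shift-invariant subset of $\{0,1\}^{\mathbb{Z}^d}$), $\mathrm{Aut}(\mathbb{X})$ is the group of all homeomorphisms of $\mathbb{X}$ (not necessarily commuting with the shifts), and $\mathcal{G}=\{T_t|_{\mathbb{X}} : t\in\mathbb{Z}^d\}$. The symmetry group is the centraliser $\mathcal{S}(\mathbb{X})=\{H\in\mathrm{Aut}(\mathbb{X}) : GH=HG \text{ for all } G\in\mathcal{G}\}$, and the extended symmetry group is the normaliser $\mathcal{R}(\mathbb{X})=\{H\in\mathrm{Aut}(\mathbb{X}) : H\mathcal{G}H^{-1}=\mathcal{G}\}$. $\mathcal{S}(\mathbb{X})=\mathbb{Z}^d$ means $\mathcal{S}(\mathbb{X})=\mathcal{G}$ with $\mathcal{G}\simeq\mathbb{Z}^d$. The affine lattice group $\mathbb{Z}^d\rtimes\mathrm{GL}(d,\mathbb{Z})$, with multiplication $(t,M)(s,N)=(t+Ms,MN)$, acts on subsets by $(t,M)\cdot U=MU+t$; the identity $\mathcal{R}(\mathbb{X})=\mathbb{Z}^d\rtimes\mathrm{GL}(d,\mathbb{Z})$ is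 understood with respect to this action. *)

theory Defs
  imports "HOL-Analysis.Analysis" "HOL-Algebra.Bij" "HOL-Algebra.Group_Action"
begin

text \<open>A subset \<open>U\<close> of \<open>\<int>\<^sup>d\<close> is its own configuration: the topology on sets is pulled back
  along the bijection of \<open>U\<close> with its indicator function.\<close>

definition local_topology :: "(int ^ 'd) set topology" where
  "local_topology = pullback_topology UNIV (\<lambda>U n. n \<in> U)
     (product_topology (\<lambda>_. discrete_topology (UNIV :: bool set)) UNIV)"

text \<open>On indicator functions this is \<open>(T\<^sub>t x)\<^sub>n = x\<^bsub>n + t\<^esub>\<close>.\<close>

definition shift :: "int ^ 'd \<Rightarrow> (int ^ 'd) set \<Rightarrow> (int ^ 'd) set" where
  "shift t U = (\<lambda>n. n - t) ` U"

lemma mem_shift_iff: "n \<in> shift t U \<longleftrightarrow> n + t \<in> U"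
proof
  assume "n \<in> shift t U"
  then show "n + t \<in> U" by (auto simp only: shift_def diff_add_cancel)
next
  assume "n + t \<in> U"
  moreover have "n = (n + t) - t" by (simp only: add_diff_cancel)
  ultimately show "n \<in> shift t U" unfolding shift_def by (rule rev_image_eqI)
qed

definition translation_hull :: "(int ^ 'd) set \<Rightarrow> (int ^ 'd) set set" where
  "translation_hull U = local_topology closure_of range (\<lambda>t. (+) t ` U)"

definition multiples :: "nat \<Rightarrow> (int ^ 'd) set" where
  "multiples p = range (\<lambda>n. int p *s n)"

definition visible_points :: "(int ^ 'd) set" where
  "visible_points = {n. Gcd (range (\<lambda>i. n $ i)) = 1}"

definition admissible :: "(int ^ 'd) set \<Rightarrow> bool" where
  "admissible U \<longleftrightarrow> (\<forall>p::nat. prime p \<longrightarrow> (\<exists>c. U \<inter> (+) c ` multiples p = {}))"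

text \<open>Dirichlet series of Riemann's zeta function, valid for real arguments \<open>s > 1\<close>.\<close>

definition zeta :: "real \<Rightarrow> real" where
  "zeta s = (\<Sum>n. 1 / real (Suc n) powr s)"

text \<open>The open cover definition of Adler, Konheim and McAndrew, for an action \<open>T\<close> of \<open>\<int>\<^sup>d\<close> on a
  compact space \<open>X\<close>, with averages taken over the cubes \<open>[0,N)\<^sup>d\<close>. Only the values of \<open>T t\<close> on
  \<open>topspace X\<close> matter. By subadditivity the upper limit below is a limit.\<close>

definition open_cover :: "'a topology \<Rightarrow> 'a set set \<Rightarrow> bool" where
  "open_cover X \<C> \<longleftrightarrow> (\<forall>C\<in>\<C>. openin X C) \<and> \<Union>\<C> = topspace X"

definition min_subcover :: "'a topology \<Rightarrow> 'a set set \<Rightarrow> nat" where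
  "min_subcover X \<C> = (LEAST k. \<exists>\<D>\<subseteq>\<C>. finite \<D> \<and> card \<D> = k \<and> \<Union>\<D> = topspace X)"

text \<open>The common refinement of the covers \<open>(T t)\<^bsup>-1\<^esup> \<C>\<close> for \<open>t \<in> F\<close>.\<close>

definition cover_join ::
  "'a topology \<Rightarrow> ('t \<Rightarrow> 'a \<Rightarrow> 'a) \<Rightarrow> 't set \<Rightarrow> 'a set set \<Rightarrow> 'a set set" where
  "cover_join X T F \<C> = {topspace X \<inter> (\<Inter>t\<in>F. T t -` c t) | c. c \<in> F \<rightarrow> \<C>}"

definition cube :: "nat \<Rightarrow> (int ^ 'd) set" where
  "cube N = {n. \<forall>i. 0 \<le> n $ i \<and> n $ i < int N}"

definition cover_entropy ::
  "'a topology \<Rightarrow> (int ^ 'd \<Rightarrow> 'a \<Rightarrow> 'a) \<Rightarrow> 'a set set \<Rightarrow> ereal" where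
  "cover_entropy X T \<C> =
     limsup (\<lambda>N. ereal (ln (real (min_subcover X (cover_join X T (cube N) \<C>)))
                        / real (card (cube N :: (int ^ 'd) set))))"

definition topological_entropy ::
  "'a topology \<Rightarrow> (int ^ 'd \<Rightarrow> 'a \<Rightarrow> 'a) \<Rightarrow> ereal" where
  "topological_entropy X T = (SUP \<C>\<in>{\<C>. open_cover X \<C>}. cover_entropy X T \<C>)"

text \<open>All self-homeomorphisms of a space under composition; as in \<^const>\<open>BijGroup\<close>, maps are
  extensional, that is, \<^const>\<open>undefined\<close> outside the space.\<close>

definition homeo_group :: "'a topology \<Rightarrow> ('a \<Rightarrow> 'a) monoid" where
  "homeo_group X =
     BijGroup (topspace X) \<lparr>carrier := {H \<in> extensional (topspace X). homeomorphic_map X X H}\<rparr>"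

definition Aut :: "(int ^ 'd) set set \<Rightarrow> ((int ^ 'd) set \<Rightarrow> (int ^ 'd) set) monoid" where
  "Aut X = homeo_group (subtopology local_topology X)"

definition shift_on ::
  "(int ^ 'd) set set \<Rightarrow> int ^ 'd \<Rightarrow> (int ^ 'd) set \<Rightarrow> (int ^ 'd) set" where
  "shift_on X t = restrict (shift t) X"

definition shifts :: "(int ^ 'd) set set \<Rightarrow> ((int ^ 'd) set \<Rightarrow> (int ^ 'd) set) set" where
  "shifts X = range (shift_on X)"

definition symmetry_group ::
  "(int ^ 'd) set set \<Rightarrow> ((int ^ 'd) set \<Rightarrow> (int ^ 'd) set) set" where
  "symmetry_group X =
     {H \<in> carrier (Aut X). \<forall>G \<in> shifts X. G \<otimes>\<^bsub>Aut X\<^esub> H = H \<otimes>\<^bsub>Aut X\<^esub> G}"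

definition extended_symmetry_group ::
  "(int ^ 'd) set set \<Rightarrow> ((int ^ 'd) set \<Rightarrow> (int ^ 'd) set) set" where
  "extended_symmetry_group X = normalizer (Aut X) (shifts X)"

text \<open>Conjugation by \<open>H\<close> in the library's normaliser is the coset product below.\<close>

lemma extended_symmetry_group_altdef:
  assumes "shifts X \<subseteq> carrier (Aut X)"
  shows "extended_symmetry_group X =
    {H \<in> carrier (Aut X). H <#\<^bsub>Aut X\<^esub> shifts X #>\<^bsub>Aut X\<^esub> inv\<^bsub>Aut X\<^esub> H = shifts X}"
  unfolding extended_symmetry_group_def normalizer_def stabilizer_def
  using assms by (simp only: restrict_apply mem_Collect_eq if_True)

definition lattice_group :: "(int ^ 'd) monoid" where
  "lattice_group = \<lparr>carrier = UNIV, mult = (+), one = 0\<rparr>"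

text \<open>\<open>\<int>\<^sup>d \<rtimes> GL(d, \<int>)\<close>; invertibility is over the integers.\<close>

definition affine_lattice_group :: "((int ^ 'd) \<times> (int ^ 'd ^ 'd)) monoid" where
  "affine_lattice_group =
     \<lparr>carrier = UNIV \<times> {M. invertible M},
      mult = (\<lambda>(t, M) (s, N). (t + M *v s, M ** N)),
      one = (0, mat 1)\<rparr>"

definition affine_action ::
  "(int ^ 'd) \<times> (int ^ 'd ^ 'd) \<Rightarrow> (int ^ 'd) set \<Rightarrow> (int ^ 'd) set" where
  "affine_action = (\<lambda>(t, M) U. (\<lambda>n. M *v n + t) ` U)"

end

theory Submission
  imports Defs "HOL-Number_Theory.Cong" "HOL-Real_Asymp.Real_Asymp"
begin

text \<open>Everything is deduced from the description of the hull as the space \<open>\<A>\<close> of admissible sets, in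
which the residues modulo different primes can be prescribed independently of each other.

\<^bold>\<open>The hull.\<close> Missing a coset of \<open>p \<int>\<^sup>d\<close> is a closed condition, because there are only \<open>p\<^sup>d\<close>
cosets; hence \<open>\<A>\<close> is closed and contains the translates of the visible points \<open>V\<close>. Conversely, let
\<open>U\<close> be admissible and let a finite window be given. A translation vector \<open>t\<close> is congruent modulo
each small prime to a missed class of \<open>U\<close>, and each point of the window outside \<open>U\<close> gets a large
prime of its own modulo which it is congruent to \<open>t\<close>. The remaining primes are harmless if first one
coordinate of \<open>t\<close> is fixed, which leaves finitely many primes that can divide some \<open>n - t\<close>, and these
are then avoided with a second coordinate (\<open>visible_pattern\<close>). This is where \<open>d \<ge> 2\<close> enters.

\<^bold>\<open>Symmetries.\<close> A continuous map \<open>H\<close> of \<open>\<A>\<close> commuting with the shifts is given by a local rule. Let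
\<open>e \<in> H {0}\<close> and \<open>w \<in> H U\<close> for a finite admissible \<open>U\<close>, and suppose that \<open>w - e \<notin> U\<close>. For a prime \<open>p\<close>
separating \<open>w - e\<close> from \<open>U\<close>, add to \<open>U\<close> widely spaced points in all classes modulo \<open>p\<close> except that of
\<open>w - e\<close>, keeping the set admissible. The image then contains \<open>w\<close> and all the added points translated
by \<open>e\<close>, so it meets every class modulo \<open>p\<close>, a contradiction. Hence \<open>H U \<subseteq> U + e\<close>
(\<open>block_code.image_subset\<close>). If \<open>H\<close> is invertible, the same inclusion for its inverse shows that
\<open>H\<close> is the translation by \<open>e\<close>. An element of the normaliser induces an additive bijection of
\<open>\<int>\<^sup>d\<close>, that is, a matrix in \<open>GL(d, \<int>)\<close>; after composition with the inverse matrix it commutes with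
the shifts, so it is affine. All affine maps occur, since they permute the cosets of \<open>p \<int>\<^sup>d\<close>.

\<^bold>\<open>Entropy.\<close> By compactness, the subcovers are controlled by the number of patterns that admissible
sets leave in a cube. A pattern misses one class for each \<open>p\<close> in a finite set \<open>P\<close> of primes, and by the
Chinese remainder theorem a proportion \<open>\<Prod>p\<in>P. 1 - p\<^bsup>-d\<^esup>\<close> of the points avoids the chosen classes,
which bounds the entropy by \<open>ln 2\<close> times this product. Conversely, every subset of \<open>V\<close> is admissible,
and \<open>V\<close> is obtained from the points that avoid the zero class for all \<open>p \<le> K\<close> by removing
nonzero multiples of numbers beyond \<open>K\<close>, whose proportion is at most \<open>2\<^sup>d\<close> times a tail of the convergent
series \<open>\<Sum>m. m\<^bsup>-d\<^esup>\<close>. By Euler's product both bounds tend to \<open>ln 2 / \<zeta>(d)\<close>.\<close>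

(* Both the closure in a topological space and the closure under an equivalence are written
   closure_of; below it is always the former. *)
no_notation eq_closure_of ("closure'_of\<index>")

section \<open>The local topology\<close>

lemma topspace_local_topology [simp]: "topspace local_topology = UNIV"
  by (simp add: local_topology_def topspace_pullback_topology)

text \<open>The factors of the product are discrete and only finitely many of them are restricted by a basic
  open set, so the cylinders over finite windows form a base.\<close>

lemma openin_local_topology_iff:
  "openin local_topology \<U> \<longleftrightarrow>
     (\<forall>U\<in>\<U>. \<exists>F. finite F \<and> (\<forall>W. W \<inter> F = U \<inter> F \<longrightarrow> W \<in> \<U>))" (is "_ \<longleftrightarrow> ?cyl")
proof
  let ?P = "product_topology (\<lambda>_. discrete_topology (UNIV :: bool set)) (UNIV :: (int^'a) set)"
  assume "openin local_topology \<U>"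
  then obtain O' where O': "openin ?P O'" "\<U> = (\<lambda>U n. n \<in> U) -` O'"
    by (auto simp: local_topology_def openin_pullback_topology)
  show ?cyl
  proof
    fix U assume "U \<in> \<U>"
    with O' obtain B where B: "finite {i. B i \<noteq> UNIV}" "(\<lambda>n. n \<in> U) \<in> PiE UNIV B" "PiE UNIV B \<subseteq> O'"
      unfolding openin_product_topology_alt by fastforce
    have "W \<in> \<U>" if "W \<inter> {i. B i \<noteq> UNIV} = U \<inter> {i. B i \<noteq> UNIV}" for W
    proof -
      have "(n \<in> W) \<in> B n" for n
      proof (cases "B n = UNIV")
        case False
        then have "n \<in> W \<longleftrightarrow> n \<in> U" using that by blast
        then show ?thesis using B(2) by (auto simp: PiE_iff)
      qed simp
      then have "(\<lambda>n. n \<in> W) \<in> PiE UNIV B" by (auto simp: PiE_iff)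
      then show ?thesis using B(3) O'(2) by auto
    qed
    then show "\<exists>F. finite F \<and> (\<forall>W. W \<inter> F = U \<inter> F \<longrightarrow> W \<in> \<U>)" using B(1) by blast
  qed
next
  let ?P = "product_topology (\<lambda>_. discrete_topology (UNIV :: bool set)) (UNIV :: (int^'a) set)"
  assume cyl: ?cyl
  have "openin ?P {x. {n. x n} \<in> \<U>}"
    unfolding openin_product_topology_alt
  proof (intro ballI)
    fix x assume "x \<in> {x. {n. x n} \<in> \<U>}"
    then obtain F where F: "finite F" "\<And>W. W \<inter> F = {n. x n} \<inter> F \<Longrightarrow> W \<in> \<U>" using cyl by blast
    define B where "B i = (if i \<in> F then {x i} else UNIV)" for i
    have "y \<in> {x. {n. x n} \<in> \<U>}" if "y \<in> PiE UNIV B" for y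
    proof -
      have "y n = x n" if "n \<in> F" for n
        using \<open>y \<in> PiE UNIV B\<close> that by (auto simp: PiE_iff B_def dest!: spec[of _ n])
      then show ?thesis by (auto intro!: F(2))
    qed
    moreover have "{i \<in> UNIV. B i \<noteq> topspace (discrete_topology UNIV)} \<subseteq> F"
      by (auto simp: B_def)
    moreover have "x \<in> PiE UNIV B" by (auto simp: B_def)
    ultimately show "\<exists>B. finite {i \<in> UNIV. B i \<noteq> topspace (discrete_topology UNIV)} \<and>
        (\<forall>i\<in>UNIV. openin (discrete_topology UNIV) (B i)) \<and> x \<in> PiE UNIV B \<and>
        PiE UNIV B \<subseteq> {x. {n. x n} \<in> \<U>}"
      using F(1) by (intro exI[of _ B]) (auto intro: finite_subset)
  qed
  moreover have "\<U> = (\<lambda>U n. n \<in> U) -` {x. {n. x n} \<in> \<U>} \<inter> UNIV" by auto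
  ultimately show "openin local_topology \<U>"
    unfolding local_topology_def openin_pullback_topology by blast
qed

lemma openin_local_topologyD:
  assumes "openin local_topology \<U>" "U \<in> \<U>"
  obtains F where "finite F" "\<And>W. W \<inter> F = U \<inter> F \<Longrightarrow> W \<in> \<U>"
  using assms(1)[unfolded openin_local_topology_iff, rule_format, OF assms(2)] by metis

lemma openin_cylinder:
  assumes "finite F" shows "openin local_topology {W. W \<inter> F = U \<inter> F}"
  unfolding openin_local_topology_iff using assms by blast

lemma compact_space_local_topology: "compact_space local_topology"
proof -
  let ?P = "product_topology (\<lambda>_. discrete_topology (UNIV :: bool set)) (UNIV :: (int^'a) set)"
  have "compact_space ?P" by (simp add: compact_space_product_topology compact_space_discrete_topology)
  moreover have "continuous_map ?P local_topology (\<lambda>x. {n. x n})"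
    unfolding local_topology_def by (rule continuous_map_pullback') (auto simp: o_def)
  ultimately have "compactin local_topology ((\<lambda>x. {n. x n}) ` topspace ?P)"
    unfolding compact_space_def by (rule image_compactin)
  moreover have "W \<in> (\<lambda>x. {n. x n}) ` topspace ?P" for W :: "(int^'a) set"
    by (rule image_eqI[of _ _ "\<lambda>n. n \<in> W"]) simp_all
  then have "(\<lambda>x. {n. x n}) ` topspace ?P = UNIV" by blast
  ultimately show ?thesis
    unfolding compact_space_def topspace_local_topology by simp
qed

text \<open>The analogue of a Lebesgue number. Each configuration lies in a cylinder inside a member of the
  cover; by compactness finitely many of these cylinders suffice, and the union of their windows
  works for all configurations at once.\<close>

lemma open_cover_window:
  assumes "closedin local_topology X" "open_cover (subtopology local_topology X) \<C>"
  obtains F where "finite F"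
    "\<And>U. U \<in> X \<Longrightarrow> \<exists>C\<in>\<C>. \<forall>W\<in>X. W \<inter> F = U \<inter> F \<longrightarrow> W \<in> C"
proof -
  have ex: "\<exists>F. finite F \<and> (\<exists>C\<in>\<C>. \<forall>W\<in>X. W \<inter> F = U \<inter> F \<longrightarrow> W \<in> C)" if U: "U \<in> X" for U
  proof -
    have "U \<in> \<Union>\<C>" using assms(2) U by (simp add: open_cover_def)
    then obtain C where C: "C \<in> \<C>" "U \<in> C" by blast
    then have "openin (subtopology local_topology X) C" using assms(2) by (simp add: open_cover_def)
    then obtain O' where O': "openin local_topology O'" "C = O' \<inter> X"
      unfolding openin_subtopology by (elim exE conjE) rule
    have "U \<in> O'" using C(2) O'(2) by blast
    then obtain F where "finite F" "\<And>W. W \<inter> F = U \<inter> F \<Longrightarrow> W \<in> O'"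
      using openin_local_topologyD[OF O'(1)] by metis
    then show ?thesis using C(1) O'(2) by (intro exI[of _ F] conjI bexI[of _ C]) simp_all
  qed
  then obtain F where F: "\<And>U. U \<in> X \<Longrightarrow> finite (F U)"
      "\<And>U. U \<in> X \<Longrightarrow> \<exists>C\<in>\<C>. \<forall>W\<in>X. W \<inter> F U = U \<inter> F U \<longrightarrow> W \<in> C" by metis
  define cyl where "cyl U = {W. W \<inter> F U = U \<inter> F U}" for U
  have "compactin local_topology X"
    using assms(1) compact_space_local_topology by (rule closedin_compact_space[rotated])
  moreover have "openin local_topology C" if "C \<in> cyl ` X" for C
    using that F(1) by (auto simp: cyl_def intro: openin_cylinder)
  moreover have "X \<subseteq> \<Union>(cyl ` X)" by (auto simp: cyl_def)
  ultimately obtain \<F> where \<F>: "finite \<F>" "\<F> \<subseteq> cyl ` X" "X \<subseteq> \<Union>\<F>"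
    unfolding compactin_def by metis
  then obtain Y where Y: "Y \<subseteq> X" "finite Y" "\<F> = cyl ` Y"
    by (meson finite_subset_image)
  show ?thesis
  proof
    \<comment> \<open>A configuration agreeing with \<open>U\<close> on the union agrees on \<open>F Z\<close> with the centre \<open>Z\<close> of a
      cylinder containing \<open>U\<close>, so the member chosen for \<open>Z\<close> contains it.\<close>
    show "finite (\<Union>(F ` Y))" using Y F(1) by auto
    fix U assume U: "U \<in> X"
    then obtain Z where Z: "Z \<in> Y" "U \<in> cyl Z" using \<F>(3) Y(3) by auto
    then have UZ: "U \<inter> F Z = Z \<inter> F Z" by (simp add: cyl_def)
    have "Z \<in> X" using Z Y by auto
    from F(2)[OF this] obtain C where C: "C \<in> \<C>" "\<And>W. W \<in> X \<Longrightarrow> W \<inter> F Z = Z \<inter> F Z \<Longrightarrow> W \<in> C"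
      by metis
    have "W \<in> C" if "W \<in> X" "W \<inter> \<Union>(F ` Y) = U \<inter> \<Union>(F ` Y)" for W
    proof (rule C(2))
      have "W \<inter> F Z = U \<inter> F Z" using that(2) Z(1) by blast
      with UZ show "W \<inter> F Z = Z \<inter> F Z" by simp
    qed fact
    with C(1) show "\<exists>C\<in>\<C>. \<forall>W\<in>X. W \<inter> \<Union>(F ` Y) = U \<inter> \<Union>(F ` Y) \<longrightarrow> W \<in> C" by metis
  qed
qed

lemma mem_closure_local_iff:
  "U \<in> local_topology closure_of \<W> \<longleftrightarrow> (\<forall>F. finite F \<longrightarrow> (\<exists>W\<in>\<W>. W \<inter> F = U \<inter> F))"
proof
  assume U: "U \<in> local_topology closure_of \<W>"
  show "\<forall>F. finite F \<longrightarrow> (\<exists>W\<in>\<W>. W \<inter> F = U \<inter> F)"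
  proof (intro allI impI)
    fix F :: "(int^'a) set" assume "finite F"
    then have "openin local_topology {W. W \<inter> F = U \<inter> F}" by (rule openin_cylinder)
    moreover have "U \<in> {W. W \<inter> F = U \<inter> F}" by simp
    moreover have "\<forall>T. U \<in> T \<and> openin local_topology T \<longrightarrow> (\<exists>W. W \<in> \<W> \<and> W \<in> T)"
      using U unfolding in_closure_of by simp
    ultimately have "\<exists>W. W \<in> \<W> \<and> W \<in> {W. W \<inter> F = U \<inter> F}" by (metis (mono_tags, lifting))
    then show "\<exists>W\<in>\<W>. W \<inter> F = U \<inter> F" by blast
  qed
next
  assume R: "\<forall>F. finite F \<longrightarrow> (\<exists>W\<in>\<W>. W \<inter> F = U \<inter> F)"
  show "U \<in> local_topology closure_of \<W>"
    unfolding in_closure_of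
  proof (intro conjI allI impI)
    fix \<U> assume "U \<in> \<U> \<and> openin local_topology \<U>"
    then obtain F where "finite F" "\<And>W. W \<inter> F = U \<inter> F \<Longrightarrow> W \<in> \<U>"
      using openin_local_topologyD by metis
    then show "\<exists>y. y \<in> \<W> \<and> y \<in> \<U>" using R by metis
  qed simp
qed

text \<open>With \<open>continuous_map_local_window\<close> below, the theorem of Curtis, Hedlund and Lyndon: a map of a
  closed set of configurations to itself is continuous if and only if every coordinate of the image depends on a finite window.\<close>

lemma continuous_map_localI:
  fixes X :: "(int ^ 'd) set set"
  assumes "\<And>U. U \<in> X \<Longrightarrow> f U \<in> X"
    and "\<And>n. \<exists>F. finite F \<and> (\<forall>U\<in>X. \<forall>W\<in>X. W \<inter> F = U \<inter> F \<longrightarrow> n \<in> f W \<longleftrightarrow> n \<in> f U)"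
  shows "continuous_map (subtopology local_topology X) (subtopology local_topology X) f"
  unfolding continuous_map_in_subtopology
proof
  show "f \<in> topspace (subtopology local_topology X) \<rightarrow> X" using assms(1) by simp
  show "continuous_map (subtopology local_topology X) local_topology f"
    unfolding continuous_map
  proof (intro conjI allI impI)
    show "f ` topspace (subtopology local_topology X) \<subseteq> topspace local_topology" by simp
    fix \<U> :: "(int^'d) set set" assume \<U>: "openin local_topology \<U>"
    define T where "T = {U. \<exists>F. finite F \<and> (\<forall>W\<in>X. W \<inter> F = U \<inter> F \<longrightarrow> f W \<in> \<U>)}"
    have "openin local_topology T"
      unfolding openin_local_topology_iff
    proof
      fix U assume "U \<in> T"
      then obtain F where F: "finite F" "\<forall>W\<in>X. W \<inter> F = U \<inter> F \<longrightarrow> f W \<in> \<U>" unfolding T_def by auto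
      have "V \<in> T" if "V \<inter> F = U \<inter> F" for V
        unfolding T_def using F by (simp only: mem_Collect_eq that[symmetric]) blast
      then show "\<exists>F. finite F \<and> (\<forall>W. W \<inter> F = U \<inter> F \<longrightarrow> W \<in> T)" using F(1) by metis
    qed
    have win: "\<exists>F. finite F \<and> (\<forall>W\<in>X. W \<inter> F = U \<inter> F \<longrightarrow> f W \<in> \<U>)" if U: "U \<in> X" "f U \<in> \<U>" for U
    proof -
      obtain G where G: "finite G" "\<And>W. W \<inter> G = f U \<inter> G \<Longrightarrow> W \<in> \<U>"
        using openin_local_topologyD[OF \<U> U(2)] by metis
      obtain F where F: "\<And>n. finite (F n)"
          "\<And>n U W. U \<in> X \<Longrightarrow> W \<in> X \<Longrightarrow> W \<inter> F n = U \<inter> F n \<Longrightarrow> n \<in> f W \<longleftrightarrow> n \<in> f U"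
        using assms(2) by metis
      have "f W \<in> \<U>" if W: "W \<in> X" "W \<inter> \<Union>(F ` G) = U \<inter> \<Union>(F ` G)" for W
      proof (rule G(2))
        have "n \<in> f W \<longleftrightarrow> n \<in> f U" if "n \<in> G" for n
          by (rule F(2)) (use W U that in blast)+
        then show "f W \<inter> G = f U \<inter> G" by blast
      qed
      then show ?thesis using F(1) G(1) by (intro exI[of _ "\<Union>(F ` G)"]) auto
    qed
    have "T \<inter> X = {U \<in> X. f U \<in> \<U>}"
    proof (intro equalityI subsetI)
      fix U assume "U \<in> {U \<in> X. f U \<in> \<U>}"
      then show "U \<in> T \<inter> X" unfolding T_def using win[of U] by simp
    next
      fix U assume "U \<in> T \<inter> X"
      then show "U \<in> {U \<in> X. f U \<in> \<U>}" unfolding T_def by auto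
    qed
    with \<open>openin local_topology T\<close> show "openin (subtopology local_topology X)
        {x \<in> topspace (subtopology local_topology X). f x \<in> \<U>}"
      unfolding openin_subtopology by (intro exI[of _ T]) simp
  qed
qed

lemma continuous_map_local_window:
  assumes "closedin local_topology X"
    and f: "continuous_map (subtopology local_topology X) (subtopology local_topology X) f"
  obtains F where "finite F"
    "\<And>U W. U \<in> X \<Longrightarrow> W \<in> X \<Longrightarrow> W \<inter> F = U \<inter> F \<Longrightarrow> n \<in> f W \<longleftrightarrow> n \<in> f U"
proof -
  let ?T = "subtopology local_topology X"
  \<comment> \<open>Whether \<open>n\<close> lies in the image splits the space into two open sets.\<close>
  define pre where "pre b = {U \<in> X. f U \<in> {W. W \<inter> {n} = (if b then {n} else {}) \<inter> {n}}}" for b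
  have "openin ?T (pre b)" for b
  proof -
    have "continuous_map ?T local_topology f" using f by (simp add: continuous_map_in_subtopology)
    then have "openin ?T {U \<in> topspace ?T. f U \<in> {W. W \<inter> {n} = (if b then {n} else {}) \<inter> {n}}}"
      by (rule openin_continuous_map_preimage) (rule openin_cylinder, simp)
    then show ?thesis by (simp add: pre_def)
  qed
  moreover have "pre True \<union> pre False = X" by (auto simp: pre_def)
  ultimately have "open_cover ?T {pre True, pre False}" by (auto simp: open_cover_def)
  then obtain F where F: "finite F"
    "\<And>U. U \<in> X \<Longrightarrow> \<exists>C\<in>{pre True, pre False}. \<forall>W\<in>X. W \<inter> F = U \<inter> F \<longrightarrow> W \<in> C"
    by (rule open_cover_window[OF assms(1)]) metis
  show ?thesis
  proof (rule that[OF F(1)])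
    fix U W assume "U \<in> X" "W \<in> X" "W \<inter> F = U \<inter> F"
    with F(2)[of U] obtain C where "C \<in> {pre True, pre False}" "U \<in> C" "W \<in> C" by metis
    then obtain b where "U \<in> pre b" "W \<in> pre b" by (elim insertE) auto
    then show "n \<in> f W \<longleftrightarrow> n \<in> f U" by (auto simp: pre_def split: if_splits)
  qed
qed

section \<open>Congruences of lattice points and admissible sets\<close>

definition vcong :: "int \<Rightarrow> int ^ 'd \<Rightarrow> int ^ 'd \<Rightarrow> bool" where
  "vcong m x y \<longleftrightarrow> (\<forall>i. m dvd x $ i - y $ i)"

definition vmod :: "int \<Rightarrow> int ^ 'd \<Rightarrow> int ^ 'd" where
  "vmod m x = (\<chi> i. x $ i mod m)"

lemma vcong_refl [simp]: "vcong m x x"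
  by (simp add: vcong_def)

lemma vcong_sym: "vcong m x y \<Longrightarrow> vcong m y x"
  by (simp add: vcong_def dvd_diff_commute)

lemma vcong_trans: "vcong m x y \<Longrightarrow> vcong m y z \<Longrightarrow> vcong m x z"
  unfolding vcong_def
proof
  fix i assume "\<forall>i. m dvd x $ i - y $ i" "\<forall>i. m dvd y $ i - z $ i"
  then have "m dvd (x $ i - y $ i) + (y $ i - z $ i)" by (intro dvd_add) auto
  then show "m dvd x $ i - z $ i" by simp
qed

lemma vcong_diff_0: "vcong m (x - y) 0 \<longleftrightarrow> vcong m x y"
  by (simp add: vcong_def)

lemma vcong_add_right_cancel: "vcong m (x + z) (y + z) \<longleftrightarrow> vcong m x y"
  by (simp add: vcong_def)

lemma vcong_dvd: "vcong m x y \<Longrightarrow> k dvd m \<Longrightarrow> vcong k x y"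
  unfolding vcong_def using dvd_trans by blast

lemma vcong_vmod: "vcong m (vmod m x) x"
  by (simp add: vcong_def vmod_def mod_eq_dvd_iff[symmetric])

lemma vcong_iff_vmod: "vcong m x y \<longleftrightarrow> vmod m x = vmod m y"
  by (simp add: vcong_def vmod_def mod_eq_dvd_iff vec_eq_iff)

lemma vmod_in_cube: "p > 0 \<Longrightarrow> vmod (int p) x \<in> cube p"
  by (simp add: vmod_def cube_def)

lemma vmod_cube: "x \<in> cube p \<Longrightarrow> vmod (int p) x = x"
  by (simp add: vmod_def cube_def vec_eq_iff)

lemma
  shows finite_cube [simp]: "finite (cube N :: (int ^ 'd) set)"
    and card_cube: "card (cube N :: (int ^ 'd) set) = N ^ CARD('d)"
proof -
  have bij: "bij_betw vec_nth (cube N :: (int ^ 'd) set) (PiE UNIV (\<lambda>_. {0..<int N}))"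
    by (rule bij_betw_byWitness[where f' = vec_lambda]) (auto simp: cube_def PiE_iff)
  have "finite (PiE (UNIV :: 'd set) (\<lambda>_. {0..<int N}))" by (intro finite_PiE) auto
  then show "finite (cube N :: (int ^ 'd) set)" using bij bij_betw_finite by blast
  show "card (cube N :: (int ^ 'd) set) = N ^ CARD('d)"
    using bij_betw_same_card[OF bij] by (simp add: card_PiE)
qed

lemma mem_coset_iff: "n \<in> (+) c ` multiples p \<longleftrightarrow> vcong (int p) n c"
proof
  assume "n \<in> (+) c ` multiples p"
  then show "vcong (int p) n c" by (auto simp: multiples_def vcong_def)
next
  assume "vcong (int p) n c"
  then obtain k where "\<And>i. n $ i - c $ i = int p * k i" unfolding vcong_def dvd_def by metis
  then have "n = c + int p *s vec_lambda k" by (simp add: vec_eq_iff algebra_simps)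
  then show "n \<in> (+) c ` multiples p" by (auto simp: multiples_def)
qed

lemma admissible_iff:
  "admissible U \<longleftrightarrow> (\<forall>p. prime p \<longrightarrow> (\<exists>c. \<forall>u\<in>U. \<not> vcong (int p) u c))"
  unfolding admissible_def disjoint_iff mem_coset_iff Ball_def ..

lemma visible_iff: "n \<in> visible_points \<longleftrightarrow> (\<forall>p. prime p \<longrightarrow> \<not> vcong (int p) n 0)"
proof -
  have dvd: "vcong k n 0 \<longleftrightarrow> k dvd Gcd (range (\<lambda>i. n $ i))" for k
    by (auto simp: vcong_def dvd_Gcd_iff)
  define G where "G = nat (Gcd (range (\<lambda>i. n $ i)))"
  have G: "Gcd (range (\<lambda>i. n $ i)) = int G"
    using Gcd_int_greater_eq_0[of "range (\<lambda>i. n $ i)"] by (simp add: G_def)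
  have "n \<in> visible_points \<longleftrightarrow> G = 1" by (simp add: visible_points_def G)
  also have "\<dots> \<longleftrightarrow> (\<forall>p. prime p \<longrightarrow> \<not> p dvd G)"
    using prime_factor_nat[of G] not_prime_1 by auto
  finally show ?thesis unfolding dvd G int_dvd_int_iff .
qed

lemma visible_points_eq: "(visible_points :: (int ^ 'd) set) = UNIV - (\<Union>p\<in>{p. prime p}. multiples p)"
proof -
  have "n \<in> multiples p \<longleftrightarrow> vcong (int p) n 0" for n :: "int ^ 'd" and p
    using mem_coset_iff[of n 0 p] by simp
  then show ?thesis by (auto simp: visible_iff)
qed

lemma admissible_subset: "admissible U \<Longrightarrow> W \<subseteq> U \<Longrightarrow> admissible W"
  unfolding admissible_iff by blast

lemma admissible_shift: 
  assumes "admissible U" shows "admissible (shift t U)"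
  unfolding admissible_iff
proof (intro allI impI)
  fix p :: nat assume "prime p"
  then obtain c where c: "\<And>u. u \<in> U \<Longrightarrow> \<not> vcong (int p) u c" using assms unfolding admissible_iff by blast
  have "\<not> vcong (int p) u (c - t)" if "u \<in> shift t U" for u
    using c[of "u + t"] that vcong_add_right_cancel[of "int p" u t "c - t"] by (simp add: mem_shift_iff)
  then show "\<exists>c. \<forall>u\<in>shift t U. \<not> vcong (int p) u c" by blast
qed

lemma admissible_visible: "admissible visible_points"
  unfolding admissible_iff using visible_iff by blast

text \<open>That a set meets all cosets of \<open>p \<int>\<^sup>d\<close> is witnessed by finitely many of its points, one for each of
  the \<open>p\<^sup>d\<close> cosets, so it is an open condition.\<close>

lemma closedin_admissible: "closedin local_topology {U :: (int ^ 'd) set. admissible U}"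
proof -
  have "openin local_topology {U :: (int ^ 'd) set. \<not> admissible U}"
    unfolding openin_local_topology_iff
  proof
    fix U :: "(int ^ 'd) set" assume "U \<in> {U. \<not> admissible U}"
    then obtain p where p: "prime p" "\<And>c. \<exists>u\<in>U. vcong (int p) u c" unfolding admissible_iff by blast
    then obtain f where f: "\<And>c. f c \<in> U" "\<And>c. vcong (int p) (f c) c" by metis
    have "\<not> admissible W" if W: "W \<inter> f ` cube p = U \<inter> f ` cube p" for W
    proof -
      have "\<exists>u\<in>W. vcong (int p) u c" for c
      proof -
        let ?c = "vmod (int p) c"
        have "?c \<in> cube p" using p(1) by (simp add: vmod_in_cube prime_gt_0_nat)
        then have "f ?c \<in> U \<inter> f ` cube p" using f(1) by simp
        then have "f ?c \<in> W" unfolding W[symmetric] by simp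
        moreover have "vcong (int p) (f ?c) c" using f(2) vcong_vmod vcong_trans by blast
        ultimately show ?thesis by blast
      qed
      then show ?thesis using p(1) unfolding admissible_iff by blast
    qed
    then show "\<exists>F. finite F \<and> (\<forall>W. W \<inter> F = U \<inter> F \<longrightarrow> W \<in> {U. \<not> admissible U})"
      by (intro exI[of _ "f ` cube p"]) simp
  qed
  moreover have "UNIV - {U :: (int ^ 'd) set. admissible U} = {U. \<not> admissible U}" by blast
  ultimately show ?thesis by (simp add: closedin_def)
qed

section \<open>The Chinese remainder theorem\<close>

lemma int_CRT:
  assumes "finite P" "\<And>p. p \<in> P \<Longrightarrow> prime (p::nat)"
  shows "\<exists>x. \<forall>p\<in>P. int p dvd x - c p"
  using assms
proof (induction P)
  case (insert p P)
  then obtain x0 where x0: "\<forall>q\<in>P. int q dvd x0 - c q" by auto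
  have "coprime (int p) (\<Prod>q\<in>P. int q)"
    using insert by (intro prod_coprime_right) (metis insertCI primes_coprime coprime_int_iff)
  then obtain x where x: "[x = c p] (mod int p)" "[x = x0] (mod (\<Prod>q\<in>P. int q))"
    using binary_chinese_remainder_int by blast
  have "int q dvd x - c q" if "q \<in> P" for q
  proof -
    have "int q dvd (\<Prod>q\<in>P. int q)" using that insert by (intro dvd_prodI) auto
    then have "int q dvd x - x0" using x(2) by (metis cong_iff_dvd_diff dvd_trans)
    moreover have "int q dvd x0 - c q" using x0 that by blast
    ultimately have "int q dvd (x - x0) + (x0 - c q)" by (rule dvd_add)
    then show ?thesis by simp
  qed
  then show ?case using x(1) by (auto simp: cong_iff_dvd_diff)
qed simp

lemma vec_CRT:
  assumes "finite P" "\<And>p. p \<in> P \<Longrightarrow> prime (p::nat)"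
  shows "\<exists>x. \<forall>p\<in>P. vcong (int p) x (c p)"
proof -
  have "\<exists>x. \<forall>p\<in>P. int p dvd x - c p $ i" for i using assms by (rule int_CRT)
  then obtain x where "\<And>i p. p \<in> P \<Longrightarrow> int p dvd x i - c p $ i" by metis
  then show ?thesis by (intro exI[of _ "vec_lambda x"]) (simp add: vcong_def)
qed

section \<open>Translates of the visible points\<close>

lemma avoid_residues:
  assumes "finite A" "card A < p"
  shows "\<exists>r. \<forall>a\<in>A. \<not> int p dvd a - r"
proof -
  have "card ((\<lambda>a. a mod int p) ` A) < card {0..<int p}"
    using card_image_le[OF assms(1), of "\<lambda>a. a mod int p"] assms(2) by simp
  then have "\<not> {0..<int p} \<subseteq> (\<lambda>a. a mod int p) ` A"
    using assms(1) by (meson card_mono finite_imageI not_less)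
  then obtain r where r: "r \<in> {0..<int p}" "r \<notin> (\<lambda>a. a mod int p) ` A" by blast
  then have "\<not> int p dvd a - r" if "a \<in> A" for a
    using that by (auto simp: mod_eq_dvd_iff[symmetric])
  then show ?thesis by blast
qed

text \<open>The vector \<open>t\<close> is first prescribed modulo the primes up to a bound \<open>L\<close>, and modulo one larger
  prime for each point of the window that must become invisible. It remains to keep the points
  of \<open>U\<close> visible modulo all other primes \<open>p\<close>. Once the coordinate \<open>t\<^sub>i\<close> is fixed, \<open>n - t\<close> can only be
  divisible by the finitely many \<open>p\<close> dividing \<open>n\<^sub>i - t\<^sub>i\<close>, and modulo these the coordinate \<open>t\<^sub>j\<close> can
  avoid all \<open>n\<^sub>j\<close> because \<open>p\<close> exceeds the number of points in the window.\<close>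

lemma visible_pattern:
  fixes U :: "(int ^ 'd) set"
  assumes dim: "CARD('d) \<ge> 2" and U: "admissible U" and F: "finite F"
  shows "\<exists>t. \<forall>n\<in>F. n - t \<in> visible_points \<longleftrightarrow> n \<in> U"
proof -
  define A B where "A = F \<inter> U" and "B = F - U"
  have fin: "finite A" "finite B" using F by (auto simp: A_def B_def)
  \<comment> \<open>\<open>L\<close> bounds the number of points of the window and the differences of their coordinates, so
    distinct points of the window remain distinct modulo a prime beyond \<open>L\<close>.\<close>
  define L where "L = card F + (\<Sum>m\<in>F. \<Sum>n\<in>F. \<Sum>i\<in>UNIV. nat \<bar>m $ i - n $ i\<bar>)"
  have L: "\<bar>m $ i - n $ i\<bar> \<le> int L" if "m \<in> F" "n \<in> F" for m n i
  proof -
    have "nat \<bar>m $ i - n $ i\<bar> \<le> (\<Sum>i\<in>UNIV. nat \<bar>m $ i - n $ i\<bar>)"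
      by (intro member_le_sum) auto
    also have "\<dots> \<le> (\<Sum>n\<in>F. \<Sum>i\<in>UNIV. nat \<bar>m $ i - n $ i\<bar>)"
      using that F by (intro member_le_sum) auto
    also have "\<dots> \<le> (\<Sum>m\<in>F. \<Sum>n\<in>F. \<Sum>i\<in>UNIV. nat \<bar>m $ i - n $ i\<bar>)"
      using that F by (intro member_le_sum[of m F "\<lambda>m. \<Sum>n\<in>F. \<Sum>i\<in>UNIV. nat \<bar>m $ i - n $ i\<bar>"]) auto
    finally show ?thesis unfolding L_def by linarith
  qed
  obtain c where c: "\<And>p u. prime p \<Longrightarrow> u \<in> U \<Longrightarrow> \<not> vcong (int p) u (c p)"
    using U unfolding admissible_iff by metis
  have "infinite {p::nat. prime p \<and> p > L}"
  proof
    assume "finite {p::nat. prime p \<and> p > L}"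
    then have "finite ({p::nat. prime p \<and> p > L} \<union> {..L})" by simp
    moreover have "{p. prime p} \<subseteq> {p::nat. prime p \<and> p > L} \<union> {..L}" by auto
    ultimately show False using primes_infinite finite_subset by blast
  qed
  then obtain PB where PB: "PB \<subseteq> {p. prime p \<and> p > L}" "finite PB" "card PB = card B"
    using infinite_arbitrarily_large by metis
  then obtain \<pi> where \<pi>: "bij_betw \<pi> B PB" using fin finite_same_card_bij by metis
  \<comment> \<open>The class of \<open>t\<close> modulo \<open>p\<close>: that of the point owning \<open>p\<close>, or else one missed by \<open>U\<close>.\<close>
  define c' where "c' p = (if p \<in> PB then inv_into B \<pi> p else c p)" for p
  define P where "P = PB \<union> {p. prime p \<and> p \<le> L}"
  have P: "finite P" "\<And>p. p \<in> P \<Longrightarrow> prime p" using PB by (auto simp: P_def)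
  obtain t0 where t0: "\<And>p. p \<in> P \<Longrightarrow> vcong (int p) t0 (c' p)" using vec_CRT[OF P] by blast
  have A_t0: "\<not> vcong (int p) n t0" if p: "p \<in> P" and n: "n \<in> A" for p n
  proof
    assume "vcong (int p) n t0"
    then have n_c': "vcong (int p) n (c' p)" by (rule vcong_trans[OF _ t0[OF p]])
    show False
    proof (cases "p \<in> PB")
      case True
      let ?b = "inv_into B \<pi> p"
      have b: "?b \<in> B" using True \<pi> by (simp add: bij_betw_def inv_into_into)
      then have "n \<noteq> ?b" using n by (auto simp: A_def B_def)
      then obtain i where i: "n $ i \<noteq> ?b $ i" by (auto simp: vec_eq_iff)
      have "int p dvd n $ i - ?b $ i" using n_c' True by (simp add: c'_def vcong_def)
      then have "int p \<le> \<bar>n $ i - ?b $ i\<bar>" using i by (intro zdvd_imp_le) auto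
      also have "\<dots> \<le> int L" using n b by (intro L) (auto simp: A_def B_def)
      finally show False using PB(1) True by auto
    next
      case False
      then show False using c[of p n] n_c' P(2)[OF p] n by (simp add: c'_def A_def)
    qed
  qed
  have B_t0: "vcong (int (\<pi> n)) n t0 \<and> \<pi> n \<in> P" if n: "n \<in> B" for n
  proof -
    have PBn: "\<pi> n \<in> PB" using bij_betwE[OF \<pi>] n by blast
    then have "\<pi> n \<in> P" by (simp add: P_def)
    moreover have "c' (\<pi> n) = n" using PBn bij_betw_inv_into_left[OF \<pi> n] by (simp add: c'_def)
    ultimately show ?thesis using t0[of "\<pi> n"] vcong_sym by metis
  qed
  obtain i j :: 'd where ij: "i \<noteq> j"
    using dim by (metis card_2_iff' card_le_Suc0_iff_eq finite not_less_eq_eq numeral_2_eq_2 UNIV_I)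
  define Q where "Q = (\<Prod>p\<in>P. int p)"
  have Q: "Q > 0" using P(2) by (auto simp: Q_def intro!: prod_pos prime_gt_0_nat)
  have dvd_Q: "int p dvd Q" if "p \<in> P" for p using that P(1) by (auto simp: Q_def intro: dvd_prodI)
  \<comment> \<open>In the right class, but so large that it differs from the \<open>i\<close>-th coordinates in the window.\<close>
  define ti where "ti = t0 $ i + Q * (\<Sum>n\<in>A. \<bar>n $ i - t0 $ i\<bar> + 1)"
  have ti: "n $ i \<noteq> ti" if n: "n \<in> A" for n
  proof -
    let ?S = "\<Sum>n\<in>A. \<bar>n $ i - t0 $ i\<bar> + 1"
    have "\<bar>n $ i - t0 $ i\<bar> + 1 \<le> ?S"
      using n fin by (intro member_le_sum[of n A "\<lambda>n. \<bar>n $ i - t0 $ i\<bar> + 1"]) auto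
    moreover have "?S \<ge> 0" by (intro sum_nonneg) auto
    then have "?S \<le> Q * ?S" using Q mult_right_mono[of 1 Q ?S] by simp
    ultimately show ?thesis unfolding ti_def by linarith
  qed
  define D where "D = (\<Prod>n\<in>A. n $ i - ti)"
  have D: "D \<noteq> 0" using fin ti by (simp add: D_def)
  \<comment> \<open>The primes that the coordinate \<open>i\<close> leaves dangerous.\<close>
  define P2 where "P2 = {p. prime p \<and> int p dvd D} - P"
  have "P2 \<subseteq> {..nat \<bar>D\<bar>}"
  proof
    fix p assume "p \<in> P2"
    then have "int p \<le> \<bar>D\<bar>" using D by (intro zdvd_imp_le) (auto simp: P2_def)
    then show "p \<in> {..nat \<bar>D\<bar>}" by auto
  qed
  then have P2: "finite P2" "\<And>p. p \<in> P2 \<Longrightarrow> prime p"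
    by (auto simp: P2_def intro: finite_subset)
  have "\<exists>r. \<forall>n\<in>A. \<not> int p dvd n $ j - r" if p: "p \<in> P2" for p
  proof -
    have "card ((\<lambda>n. n $ j) ` A) \<le> card F"
      using card_image_le[OF fin(1)] card_mono[OF F, of A] by (metis A_def Int_lower1 order_trans)
    also have "\<dots> \<le> L" by (simp add: L_def)
    also have "L < p" using p by (auto simp: P2_def P_def)
    finally have "\<exists>r. \<forall>a\<in>(\<lambda>n. n $ j) ` A. \<not> int p dvd a - r"
      using fin by (intro avoid_residues) auto
    then show ?thesis by auto
  qed
  then obtain r where r: "\<And>p n. p \<in> P2 \<Longrightarrow> n \<in> A \<Longrightarrow> \<not> int p dvd n $ j - r p" by metis
  obtain tj where tj: "\<And>p. p \<in> P \<union> P2 \<Longrightarrow> int p dvd tj - (if p \<in> P then t0 $ j else r p)"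
    using int_CRT[of "P \<union> P2" "\<lambda>p. if p \<in> P then t0 $ j else r p"] P P2 by blast
  define t where "t = (\<chi> k. if k = i then ti else if k = j then tj else t0 $ k)"
  have t_t0: "vcong (int p) t t0" if p: "p \<in> P" for p
    using tj[of p] dvd_Q[OF p] p by (auto simp: vcong_def t_def ti_def)
  have "n - t \<in> visible_points" if n: "n \<in> A" for n
    unfolding visible_iff vcong_diff_0
  proof (intro allI impI notI)
    fix p :: nat assume p: "prime p" "vcong (int p) n t"
    show False
    proof (cases "p \<in> P")
      case True
      then show False using A_t0[OF True n] vcong_trans[OF p(2) t_t0[OF True]] by blast
    next
      case False
      have "int p dvd n $ i - ti" using p(2) by (auto simp: vcong_def t_def dest: spec[of _ i])
      then have "int p dvd D" using n fin unfolding D_def by (meson dvd_prodI dvd_trans)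
      then have p2: "p \<in> P2" using p False by (simp add: P2_def)
      have "int p dvd n $ j - tj" using p(2) ij by (auto simp: vcong_def t_def dest: spec[of _ j])
      moreover have "int p dvd tj - r p" using tj[of p] p2 False by simp
      ultimately have "int p dvd (n $ j - tj) + (tj - r p)" by (rule dvd_add)
      then show False using r[OF p2 n] by simp
    qed
  qed
  moreover have "n - t \<notin> visible_points" if n: "n \<in> B" for n
  proof -
    have "vcong (int (\<pi> n)) n t0" "\<pi> n \<in> P" using B_t0[OF n] by auto
    then have "vcong (int (\<pi> n)) n t" using t_t0 vcong_sym vcong_trans by metis
    then show ?thesis unfolding visible_iff vcong_diff_0 using P(2) \<open>\<pi> n \<in> P\<close> by blast
  qed
  ultimately show ?thesis by (intro exI[of _ t]) (auto simp: A_def B_def)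
qed

lemma translation_hull_visible:
  assumes dim: "CARD('d) \<ge> 2"
  shows "translation_hull (visible_points :: (int ^ 'd) set) = {U. admissible U}"
proof
  have "(+) t ` U = shift (- t) U" for t and U :: "(int ^ 'd) set"
    by (auto simp: shift_def add.commute image_iff)
  then have "range (\<lambda>t. (+) t ` (visible_points :: (int ^ 'd) set)) \<subseteq> {U. admissible U}"
    using admissible_shift admissible_visible by auto
  then show "translation_hull (visible_points :: (int ^ 'd) set) \<subseteq> {U. admissible U}"
    unfolding translation_hull_def by (rule closure_of_minimal[OF _ closedin_admissible])
  show "{U. admissible U} \<subseteq> translation_hull (visible_points :: (int ^ 'd) set)"
  proof
    fix U :: "(int ^ 'd) set" assume "U \<in> {U. admissible U}"
    then have U: "admissible U" by simp
    show "U \<in> translation_hull visible_points"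
      unfolding translation_hull_def mem_closure_local_iff
    proof (intro allI impI)
      fix F :: "(int ^ 'd) set" assume F: "finite F"
      obtain t where t: "\<forall>n\<in>F. n - t \<in> visible_points \<longleftrightarrow> n \<in> U"
        using visible_pattern[OF dim U F] by blast
      have "n \<in> (+) t ` visible_points \<longleftrightarrow> n - t \<in> visible_points" for n
        by (metis (no_types, lifting) add_diff_cancel_left' diff_add_cancel add.commute image_iff)
      then have "(+) t ` visible_points \<inter> F = U \<inter> F" using t by auto
      then show "\<exists>W\<in>range (\<lambda>t. (+) t ` visible_points). W \<inter> F = U \<inter> F" by blast
    qed
  qed
qed

section \<open>Sparse supersets\<close>

lemma small_set_misses_class:
  fixes W :: "(int ^ 'd) set"
  assumes "finite W" "card W < p"
  shows "\<exists>c. \<forall>u\<in>W. \<not> vcong (int p) u c"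
proof -
  fix i :: 'd
  have "card ((\<lambda>n. n $ i) ` W) < p" using card_image_le[OF assms(1)] assms(2) le_less_trans by blast
  then obtain r where r: "\<forall>a\<in>(\<lambda>n. n $ i) ` W. \<not> int p dvd a - r"
    using avoid_residues[of "(\<lambda>n. n $ i) ` W" p] assms(1) by blast
  then have "\<not> vcong (int p) u (\<chi> _. r)" if "u \<in> W" for u
    using that by (auto simp: vcong_def)
  then show ?thesis by blast
qed

lemma admissible_singleton: "admissible {n}"
  unfolding admissible_iff using small_set_misses_class[of "{n}"] prime_gt_1_nat by auto

lemma not_admissible_UNIV: "\<not> admissible UNIV"
  unfolding admissible_iff using two_is_prime_nat vcong_refl by blast

text \<open>The representatives are chosen one after another: each class is infinite, and only finitely many
  of its points are too close to the points present so far.\<close>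

lemma separated_representatives:
  fixes x :: "'r \<Rightarrow> int ^ 'd"
  assumes "finite R" "finite U" "finite D" "m > 0" and sym: "\<And>d. d \<in> D \<Longrightarrow> - d \<in> D"
  shows "\<exists>s. (\<forall>r\<in>R. vcong m (s r) (x r)) \<and> (\<forall>r\<in>R. \<forall>u\<in>U \<union> s ` (R - {r}). s r - u \<notin> D)"
  using assms(1)
proof (induction R)
  case (insert r R)
  then obtain s where s: "\<And>r. r \<in> R \<Longrightarrow> vcong m (s r) (x r)"
      "\<And>r u. r \<in> R \<Longrightarrow> u \<in> U \<union> s ` (R - {r}) \<Longrightarrow> s r - u \<notin> D" by metis
  define B where "B = (\<lambda>(u, d). u + d) ` ((U \<union> s ` R) \<times> D)"
  have "finite B" using insert assms by (auto simp: B_def)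
  define y where "y k = x r + (\<chi> _. m * int k)" for k
  have "inj y" using \<open>m > 0\<close> by (auto simp: inj_def y_def vec_eq_iff)
  then have "\<not> range y \<subseteq> B" using \<open>finite B\<close> range_inj_infinite finite_subset by blast
  then obtain k where k: "y k \<notin> B" by blast
  have yk: "y k - u \<notin> D" if "u \<in> U \<union> s ` R" for u
  proof
    assume "y k - u \<in> D"
    then have "(\<lambda>(u, d). u + d) (u, y k - u) \<in> B" using that unfolding B_def by (intro imageI) blast
    then show False using k by simp
  qed
  define s' where "s' = s(r := y k)"
  have ks: "r' \<noteq> r" if "r' \<in> R" for r' using that insert by blast
  have "vcong m (s' q) (x q)" if "q \<in> insert r R" for q
    using that s(1)[of q] by (auto simp: s'_def y_def vcong_def)
  moreover have "s' q - u \<notin> D" if q: "q \<in> insert r R" and u: "u \<in> U \<union> s' ` (insert r R - {q})" for q u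
  proof (cases "q = r")
    case True
    have "u \<in> U \<union> s ` R" using u True ks by (auto simp: s'_def)
    then show ?thesis using yk True by (simp add: s'_def)
  next
    case False
    then have qR: "q \<in> R" using q by blast
    show ?thesis
    proof (cases "u \<in> U \<union> s ` (R - {q})")
      case True
      then show ?thesis using s(2)[OF qR True] False by (simp add: s'_def)
    next
      case not: False
      then have "u = y k" using u ks by (auto simp: s'_def split: if_splits)
      moreover have "y k - s q \<notin> D" using yk qR by blast
      ultimately show ?thesis using sym[of "s q - y k"] False by (auto simp: s'_def)
    qed
  qed
  ultimately show ?case by (intro exI[of _ s']) blast
qed simp

text \<open>The added points are prescribed modulo \<open>p\<close>, and modulo every other prime \<open>q\<close> up to the number of
  points they all lie in one class, chosen so that a class missed by \<open>U\<close> remains missed. For a larger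
  prime \<open>q\<close> there are too few points to meet all classes. The Chinese remainder theorem leaves
  infinitely many choices for each point, so they can be placed far apart in the sense of \<open>D\<close>.\<close>

lemma sparse_extension:
  fixes U :: "(int ^ 'd) set"
  assumes U: "finite U" "admissible U" and p: "prime p" and a: "\<And>u. u \<in> U \<Longrightarrow> \<not> vcong (int p) u a"
    and D: "finite D" "\<And>d. d \<in> D \<Longrightarrow> - d \<in> D"
  obtains S where "admissible (U \<union> S)"
    "\<And>r. \<not> vcong (int p) r a \<Longrightarrow> \<exists>s\<in>S. vcong (int p) s r"
    "\<And>s u. s \<in> S \<Longrightarrow> u \<in> U \<union> S \<Longrightarrow> u \<noteq> s \<Longrightarrow> s - u \<notin> D"
proof -
  define R :: "(int ^ 'd) set" where "R = cube p - {vmod (int p) a}"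
  define N where "N = card U + card R"
  obtain c where c: "\<And>q u. prime q \<Longrightarrow> u \<in> U \<Longrightarrow> \<not> vcong (int q) u (c q)"
    using U unfolding admissible_iff by metis
  define P where "P = insert p {q. prime q \<and> q \<le> N}"
  have P: "finite P" "\<And>q. q \<in> P \<Longrightarrow> prime q" using p by (auto simp: P_def)
  \<comment> \<open>\<open>c q + 1\<close>, with \<open>1\<close> the all-ones vector, is just some class other than \<open>c q\<close>.\<close>
  have "\<exists>x. \<forall>q\<in>P. vcong (int q) x (if q = p then r else c q + 1)" for r
    using P by (rule vec_CRT)
  then obtain x where x: "\<And>r q. q \<in> P \<Longrightarrow> vcong (int q) (x r) (if q = p then r else c q + 1)" by metis
  define m where "m = (\<Prod>q\<in>P. int q)"
  have "m > 0" using P(2) by (auto simp: m_def intro!: prod_pos prime_gt_0_nat)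
  have finR: "finite R" by (simp add: R_def)
  obtain s where s: "\<And>r. r \<in> R \<Longrightarrow> vcong m (s r) (x r)"
      "\<And>r u. r \<in> R \<Longrightarrow> u \<in> U \<union> s ` (R - {r}) \<Longrightarrow> s r - u \<notin> D"
    using separated_representatives[OF finR U(1) D(1) \<open>m > 0\<close> D(2), of x] by metis
  have sq: "vcong (int q) (s r) (if q = p then r else c q + 1)" if "r \<in> R" "q \<in> P" for r q
  proof -
    have "int q dvd m" using that P unfolding m_def by (intro dvd_prodI) auto
    then have "vcong (int q) (s r) (x r)" using s(1)[OF that(1)] vcong_dvd by blast
    then show ?thesis using x[OF that(2), of r] by (rule vcong_trans)
  qed
  show ?thesis
  proof
    show "admissible (U \<union> s ` R)"
      unfolding admissible_iff
    proof (intro allI impI)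
      fix q :: nat assume q: "prime q"
      consider "q = p" | "q \<noteq> p" "q \<in> P" | "q \<notin> P" by blast
      then show "\<exists>c. \<forall>u\<in>U \<union> s ` R. \<not> vcong (int q) u c"
      proof cases
        case 1
        have "\<not> vcong (int p) (s r) a" if r: "r \<in> R" for r
        proof
          assume "vcong (int p) (s r) a"
          moreover have "vcong (int p) r (s r)" using sq[OF r, of p] vcong_sym by (simp add: P_def)
          ultimately have "vmod (int p) r = vmod (int p) a" using vcong_trans vcong_iff_vmod by metis
          then show False using r vmod_cube[of r p] by (simp add: R_def)
        qed
        then show ?thesis using a 1 by (intro exI[of _ a]) auto
      next
        case 2
        have "\<not> vcong (int q) (s r) (c q)" if r: "r \<in> R" for r
        proof
          assume "vcong (int q) (s r) (c q)"
          moreover have "vcong (int q) (s r) (c q + 1)" using sq[OF r 2(2)] 2(1) by simp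
          ultimately have "vcong (int q) (c q) (c q + 1)" using vcong_sym vcong_trans by metis
          then show False using q prime_gt_1_nat[OF q] by (simp add: vcong_def)
        qed
        then show ?thesis using c[OF q] by (intro exI[of _ "c q"]) auto
      next
        case 3
        have "card (U \<union> s ` R) \<le> card U + card (s ` R)" by (rule card_Un_le)
        also have "\<dots> \<le> N" using card_image_le[OF finR, of s] by (simp add: N_def)
        also have "N < q" using 3 q by (auto simp: P_def)
        finally show ?thesis using U(1) finR by (intro small_set_misses_class) auto
      qed
    qed
    show "\<exists>s\<in>s ` R. vcong (int p) s r" if r: "\<not> vcong (int p) r a" for r
    proof -
      let ?r = "vmod (int p) r"
      have R: "?r \<in> R" using r vmod_in_cube[of p r] prime_gt_0_nat[OF p]
        by (simp add: R_def vcong_iff_vmod)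
      then have "vcong (int p) (s ?r) ?r" using sq[OF R, of p] by (simp add: P_def)
      then have "vcong (int p) (s ?r) r" using vcong_vmod by (rule vcong_trans)
      then show ?thesis using R by blast
    qed
    show "z - u \<notin> D" if z: "z \<in> s ` R" and u: "u \<in> U \<union> s ` R" "u \<noteq> z" for z u
    proof -
      from z obtain r where r: "z = s r" "r \<in> R" by blast
      then have "u \<in> U \<union> s ` (R - {r})" using u by blast
      then show ?thesis using s(2) r by blast
    qed
  qed
qed

lemma separating_prime:
  fixes U :: "(int ^ 'd) set"
  assumes "finite U" "a \<notin> U"
  obtains p :: nat where "prime p" "\<And>u. u \<in> U \<Longrightarrow> \<not> vcong (int p) u a"
proof -
  obtain p :: nat where p: "prime p" "(\<Sum>u\<in>U. \<Sum>i\<in>UNIV. nat \<bar>u $ i - a $ i\<bar>) < p"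
    using bigger_prime by blast
  show ?thesis
  proof (rule that[OF p(1)])
    fix u assume u: "u \<in> U"
    then obtain i where i: "u $ i \<noteq> a $ i" using assms(2) by (metis vec_eq_iff)
    have "nat \<bar>u $ i - a $ i\<bar> \<le> (\<Sum>i\<in>UNIV. nat \<bar>u $ i - a $ i\<bar>)"
      by (intro member_le_sum) auto
    also have "\<dots> \<le> (\<Sum>u\<in>U. \<Sum>i\<in>UNIV. nat \<bar>u $ i - a $ i\<bar>)"
      using u assms(1) by (intro member_le_sum[of u U "\<lambda>u. \<Sum>i\<in>UNIV. nat \<bar>u $ i - a $ i\<bar>"]) auto
    finally have "\<bar>u $ i - a $ i\<bar> < int p" using p(2) by linarith
    then have "\<not> int p dvd u $ i - a $ i" using i zdvd_imp_le[of "int p" "\<bar>u $ i - a $ i\<bar>"] by auto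
    then show "\<not> vcong (int p) u a" by (auto simp: vcong_def)
  qed
qed

section \<open>Block codes on admissible sets\<close>

text \<open>A sliding block code with window \<open>F\<close>: by equivariance, the local rule at the origin determines the
  image at every point.\<close>

locale block_code =
  fixes H :: "(int ^ 'd) set \<Rightarrow> (int ^ 'd) set" and F :: "(int ^ 'd) set"
  assumes admissible_image: "admissible U \<Longrightarrow> admissible (H U)"
    and equivariant: "admissible U \<Longrightarrow> H (shift t U) = shift t (H U)"
    and finite_window: "finite F"
    and window: "admissible U \<Longrightarrow> admissible W \<Longrightarrow> W \<inter> F = U \<inter> F \<Longrightarrow> 0 \<in> H W \<longleftrightarrow> 0 \<in> H U"
begin

lemma window_at:
  assumes "admissible U" "admissible W" "\<And>f. f \<in> F \<Longrightarrow> f + t \<in> W \<longleftrightarrow> f + t \<in> U"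
  shows "t \<in> H W \<longleftrightarrow> t \<in> H U"
proof -
  have "shift t W \<inter> F = shift t U \<inter> F" using assms(3) by (auto simp: mem_shift_iff)
  then have "0 \<in> H (shift t W) \<longleftrightarrow> 0 \<in> H (shift t U)"
    using assms by (intro window admissible_shift)
  then show ?thesis using assms by (simp add: equivariant mem_shift_iff)
qed

lemma admissible_empty: "admissible {}"
  using admissible_subset[OF admissible_singleton] by blast

text \<open>The empty set is fixed by all shifts, so its image is empty or the whole lattice,
  and the latter is not admissible.\<close>

lemma image_empty: "H {} = {}"
proof (rule ccontr)
  assume "H {} \<noteq> {}"
  then obtain t where t: "t \<in> H {}" by blast
  have "shift n {} = {}" for n :: "int ^ 'd" by (simp add: shift_def)
  then have "shift n (H {}) = H {}" for n using equivariant[OF admissible_empty] by metis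
  then have "n + t \<in> H {}" for n using t mem_shift_iff[of t n "H {}"] by (simp add: add.commute)
  then have "n \<in> H {}" for n by (metis diff_add_cancel)
  then have "H {} = UNIV" by blast
  then show False using admissible_image[OF admissible_empty] by (simp add: not_admissible_UNIV)
qed

text \<open>Since the image of the empty set is empty, a point of the image is caused by a point in its window.\<close>

lemma window_meets:
  assumes "admissible U" "t \<in> H U"
  shows "\<exists>f\<in>F. f + t \<in> U"
  using window_at[OF admissible_empty assms(1), of t] assms(2) image_empty by auto

lemma image_singleton: "t \<in> H {s} \<longleftrightarrow> t - s \<in> H {0}"
proof -
  have "{s} = shift (- s) {0}" by (simp add: shift_def)
  then have "H {s} = shift (- s) (H {0})" using equivariant[OF admissible_singleton] by metis
  then show ?thesis by (simp add: mem_shift_iff)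
qed

text \<open>This is where admissibility of the image forces rigidity. If \<open>w - e \<notin> U\<close>, then \<open>U\<close> has a sparse
  admissible extension meeting all classes modulo some prime \<open>p\<close> except that of \<open>w - e\<close>. The local rule
  sees \<open>U\<close> and each added point \<open>s\<close> separately, so the image of the extension contains \<open>w\<close> and all
  \<open>s + e\<close>, which together meet every class modulo \<open>p\<close>.\<close>

lemma finite_image_subset:
  assumes U: "finite U" "admissible U" and e: "e \<in> H {0}" and w: "w \<in> H U"
  shows "w - e \<in> U"
proof (rule ccontr)
  assume "w - e \<notin> U"
  then obtain p :: nat where p: "prime p" "\<And>u. u \<in> U \<Longrightarrow> \<not> vcong (int p) u (w - e)"
    using separating_prime U(1) by metis
  \<comment> \<open>Two points lie in a common translate of the window exactly if their difference is in \<open>D\<close>.\<close>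
  define D where "D = (\<lambda>(f, g). f - g) ` (F \<times> F)"
  have D: "finite D" "\<And>f g. f \<in> F \<Longrightarrow> g \<in> F \<Longrightarrow> f - g \<in> D"
    using finite_window by (auto simp: D_def)
  have D_sym: "- d \<in> D" if "d \<in> D" for d using that D(2) by (auto simp: D_def)
  obtain S where S: "admissible (U \<union> S)"
    "\<And>r. \<not> vcong (int p) r (w - e) \<Longrightarrow> \<exists>s\<in>S. vcong (int p) s r"
    "\<And>s u. s \<in> S \<Longrightarrow> u \<in> U \<union> S \<Longrightarrow> u \<noteq> s \<Longrightarrow> s - u \<notin> D"
    using sparse_extension[OF U p D(1) D_sym] by metis
  have wH: "w \<in> H (U \<union> S)"
  proof -
    obtain g where g: "g \<in> F" "g + w \<in> U" using window_meets[OF U(2) w] by blast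
    have "f + w \<in> U" if f: "f \<in> F" "f + w \<in> U \<union> S" for f
    proof (rule ccontr)
      assume "f + w \<notin> U"
      then have "(f + w) - (g + w) \<notin> D" using f g by (intro S(3)) auto
      then show False using D(2)[OF f(1) g(1)] by simp
    qed
    then have "w \<in> H (U \<union> S) \<longleftrightarrow> w \<in> H U" by (intro window_at U S) auto
    then show ?thesis using w by simp
  qed
  have sH: "s + e \<in> H (U \<union> S)" if s: "s \<in> S" for s
  proof -
    have se: "s + e \<in> H {s}" using image_singleton[of "s + e" s] e by simp
    obtain g where g: "g \<in> F" "g + (s + e) = s" using window_meets[OF admissible_singleton se] by blast
    have "f + (s + e) = s" if f: "f \<in> F" "f + (s + e) \<in> U \<union> S" for f
    proof (rule ccontr)
      assume "f + (s + e) \<noteq> s"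
      then have "s - (f + (s + e)) \<notin> D" using S(3)[OF s f(2)] by blast
      moreover have "s - (f + (s + e)) = (g + (s + e)) - (f + (s + e))" unfolding g(2) ..
      ultimately show False using D(2)[OF g(1) f(1)] by simp
    qed
    then have "f + (s + e) \<in> U \<union> S \<longleftrightarrow> f + (s + e) \<in> {s}" if "f \<in> F" for f
      using that s by (metis UnI2 singleton_iff)
    then have "s + e \<in> H (U \<union> S) \<longleftrightarrow> s + e \<in> H {s}"
      by (rule window_at[OF admissible_singleton S(1)])
    then show ?thesis using se by simp
  qed
  obtain c where c: "\<And>u. u \<in> H (U \<union> S) \<Longrightarrow> \<not> vcong (int p) u c"
    using admissible_image[OF S(1)] p(1) unfolding admissible_iff by blast
  have "\<not> vcong (int p) (c - e) (w - e)"
  proof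
    assume "vcong (int p) (c - e) (w - e)"
    then have "vcong (int p) w c"
      using vcong_add_right_cancel[of "int p" "c - e" e "w - e"] vcong_sym by simp
    then show False using c wH by blast
  qed
  then obtain s where s: "s \<in> S" "vcong (int p) s (c - e)" using S(2) by blast
  then have "vcong (int p) (s + e) c"
    using vcong_add_right_cancel[of "int p" s e "c - e"] by simp
  then show False using c sH s(1) by blast
qed

text \<open>Whether \<open>n\<close> is in the image is decided by a finite part of \<open>U\<close>.\<close>

lemma image_subset:
  assumes U: "admissible U" and e: "e \<in> H {0}" and n: "n \<in> H U"
  shows "n - e \<in> U"
proof -
  let ?U = "U \<inter> (\<lambda>f. f + n) ` F"
  have adm: "admissible ?U" using U admissible_subset by blast
  have "n \<in> H ?U \<longleftrightarrow> n \<in> H U" by (intro window_at U adm) auto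
  then have "n - e \<in> ?U" using n finite_window by (intro finite_image_subset[OF _ adm e]) auto
  then show ?thesis by blast
qed

end

text \<open>The inclusion \<open>H U \<subseteq> U + e\<close> determines \<open>H {0}\<close>, hence also the corresponding vector \<open>- e\<close> of the
  inverse, and the inclusion for the inverse is the converse one.\<close>

lemma invertible_block_code_is_shift:
  assumes "block_code H F" "block_code H' F'"
    and inv: "\<And>U. admissible U \<Longrightarrow> H' (H U) = U"
  shows "\<exists>e. \<forall>U. admissible U \<longrightarrow> H U = shift e U"
proof -
  interpret H: block_code H F by (rule assms(1))
  interpret H': block_code H' F' by (rule assms(2))
  have "H {0} \<noteq> {}"
  proof
    assume "H {0} = {}"
    then have "H' {} = {0}" using inv[OF admissible_singleton, of 0] by simp
    then show False using H'.image_empty by simp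
  qed
  then obtain e where e: "e \<in> H {0}" by blast
  have "H {0} = {e}" using H.image_subset[OF admissible_singleton e] e by fastforce
  then have "H' {e} = {0}" using inv[OF admissible_singleton, of 0] by simp
  then have e': "- e \<in> H' {0}" using H'.image_singleton[of 0 e] by simp
  have "H U = shift (- e) U" if U: "admissible U" for U
  proof (rule Set.set_eqI)
    fix n
    have "n \<in> H U" if "n - e \<in> U"
    proof -
      have "n - e \<in> H' (H U)" using that inv[OF U] by simp
      then have "(n - e) - (- e) \<in> H U" by (rule H'.image_subset[OF H.admissible_image[OF U] e'])
      then show ?thesis by simp
    qed
    then show "n \<in> H U \<longleftrightarrow> n \<in> shift (- e) U"
      using H.image_subset[OF U e] by (auto simp: mem_shift_iff)
  qed
  then show ?thesis by blast
qed

section \<open>Homeomorphism groups\<close>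

lemma homeo_group_carrier_Bij: "carrier (homeo_group T) \<subseteq> Bij (topspace T)"
  unfolding homeo_group_def Bij_def
  by (auto simp: bij_betw_def homeomorphic_eq_everything_map)

lemma mult_homeo_group:
  assumes "f \<in> carrier (homeo_group T)" "g \<in> carrier (homeo_group T)"
  shows "f \<otimes>\<^bsub>homeo_group T\<^esub> g = compose (topspace T) f g"
  using assms homeo_group_carrier_Bij[of T] by (auto simp: homeo_group_def BijGroup_def)

lemma group_homeo_group: "group (homeo_group T)"
proof -
  let ?C = "{H \<in> extensional (topspace T). homeomorphic_map T T H}"
  have C: "?C \<subseteq> Bij (topspace T)" using homeo_group_carrier_Bij[of T] by (simp add: homeo_group_def)
  have "subgroup ?C (BijGroup (topspace T))"
  proof (rule group.subgroupI[OF group_BijGroup])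
    show "?C \<subseteq> carrier (BijGroup (topspace T))" using C by (simp add: BijGroup_def)
    have "homeomorphic_map T T (\<lambda>x\<in>topspace T. x)"
      by (rule homeomorphic_map_eq[of T T id]) auto
    then show "?C \<noteq> {}" by (intro ex_in_conv[THEN iffD1] exI[of _ "\<lambda>x\<in>topspace T. x"]) simp
    fix f assume f: "f \<in> ?C"
    then obtain g where g: "homeomorphic_maps T T f g" by (auto simp: homeomorphic_map_maps)
    have fB: "f \<in> Bij (topspace T)" using f C by blast
    have gf: "g y = inv_into (topspace T) f y" if y: "y \<in> topspace T" for y
    proof -
      have "g y \<in> topspace T" "f (g y) = y"
        using g y by (auto simp: homeomorphic_maps_def continuous_map_def)
      then show ?thesis using fB by (metis Bij_def IntD2 bij_betw_def inv_into_f_f mem_Collect_eq)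
    qed
    have "homeomorphic_map T T g"
      using g homeomorphic_maps_imp_map homeomorphic_maps_sym by blast
    then have "homeomorphic_map T T (\<lambda>x\<in>topspace T. inv_into (topspace T) f x)"
      using gf by (auto intro: homeomorphic_map_eq)
    then show "inv\<^bsub>BijGroup (topspace T)\<^esub> f \<in> ?C" unfolding inv_BijGroup[OF fB] by simp
    fix h assume h: "h \<in> ?C"
    have "homeomorphic_map T T (f \<circ> h)" using f h by (auto intro: homeomorphic_map_compose)
    then have "homeomorphic_map T T (compose (topspace T) f h)"
      by (rule homeomorphic_map_eq) (simp add: compose_def)
    moreover have "f \<otimes>\<^bsub>BijGroup (topspace T)\<^esub> h = compose (topspace T) f h"
      using f h C by (auto simp: BijGroup_def)
    ultimately show "f \<otimes>\<^bsub>BijGroup (topspace T)\<^esub> h \<in> ?C" by simp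
  qed
  then show ?thesis unfolding homeo_group_def by (rule group.subgroup_imp_group[OF group_BijGroup])
qed

section \<open>The affine action on admissible sets\<close>

lemma vcong_matrix:
  fixes M :: "int ^ 'd ^ 'd"
  assumes "vcong m x y" shows "vcong m (M *v x) (M *v y)"
  unfolding vcong_def
proof
  fix i
  have "(M *v x) $ i - (M *v y) $ i = (\<Sum>j\<in>UNIV. M $ i $ j * (x $ j - y $ j))"
    by (simp add: matrix_vector_mult_def sum_subtractf right_diff_distrib)
  also have "m dvd \<dots>" using assms by (intro dvd_sum dvd_mult) (auto simp: vcong_def)
  finally show "m dvd (M *v x) $ i - (M *v y) $ i" .
qed

lemma affine_action_mult:
  "affine_action a (affine_action b U) = affine_action (a \<otimes>\<^bsub>affine_lattice_group\<^esub> b) U"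
  by (auto simp: affine_action_def affine_lattice_group_def image_image matrix_vector_mul_assoc
      matrix_vector_right_distrib add.commute add.left_commute split: prod.splits)

lemma affine_action_one: "affine_action (0, mat 1) U = U"
  by (auto simp: affine_action_def image_iff)

lemma matrix_vector_mult_minus: "M *v (- v) = - (M *v v)" for M :: "int ^ 'd ^ 'd"
  by (simp add: vec_eq_iff matrix_vector_mult_def sum_negf)

lemma shift_eq_affine_action: "shift t = affine_action (- t, mat 1)"
  by (simp add: affine_action_def shift_def fun_eq_iff)

text \<open>The inverse of \<open>(t, M)\<close> is \<open>(- M\<^bsup>-1\<^esup> t, M\<^bsup>-1\<^esup>)\<close>.\<close>

lemma affine_inverse:
  assumes "invertible (snd a)"
  obtains b where "invertible (snd b)" "a \<otimes>\<^bsub>affine_lattice_group\<^esub> b = (0, mat 1)"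
    "b \<otimes>\<^bsub>affine_lattice_group\<^esub> a = (0, mat 1)"
proof -
  obtain t M where a: "a = (t, M)" by (cases a)
  then obtain N where N: "M ** N = mat 1" "N ** M = mat 1" using assms by (auto simp: invertible_def)
  have "M *v (N *v v) = v" for v
    using N by (simp add: matrix_vector_mul_assoc)
  then show ?thesis
    using N a by (intro that[of "(- (N *v t), N)"])
      (auto simp: affine_lattice_group_def invertible_def matrix_vector_mult_minus)
qed

text \<open>Integral matrices respect congruences, so an invertible affine map permutes the cosets of \<open>p \<int>\<^sup>d\<close>.\<close>

lemma admissible_affine_action:
  assumes "invertible (snd a)" "admissible U"
  shows "admissible (affine_action a U)"
proof -
  obtain t M where a: "a = (t, M)" by (cases a)
  then obtain N where N: "N ** M = mat 1" using assms by (auto simp: invertible_def)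
  show ?thesis
    unfolding admissible_iff
  proof (intro allI impI)
    fix p :: nat assume "prime p"
    then obtain c where c: "\<And>u. u \<in> U \<Longrightarrow> \<not> vcong (int p) u c" using assms unfolding admissible_iff by metis
    have "\<not> vcong (int p) (M *v u + t) (M *v c + t)" if "u \<in> U" for u
    proof
      assume "vcong (int p) (M *v u + t) (M *v c + t)"
      then have "vcong (int p) (M *v u) (M *v c)" by (simp add: vcong_add_right_cancel)
      then have "vcong (int p) (N *v (M *v u)) (N *v (M *v c))" by (rule vcong_matrix)
      then show False using c[OF that] by (simp add: matrix_vector_mul_assoc N)
    qed
    then show "\<exists>c. \<forall>u\<in>affine_action a U. \<not> vcong (int p) u c"
      by (intro exI[of _ "M *v c + t"]) (auto simp: affine_action_def a)
  qed
qed

abbreviation (input) admissible_sets :: "(int ^ 'd) set set" where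
  "admissible_sets \<equiv> {U. admissible U}"

lemma carrier_Aut:
  "H \<in> carrier (Aut X) \<longleftrightarrow> H \<in> extensional X \<and>
    homeomorphic_map (subtopology local_topology X) (subtopology local_topology X) H"
  by (simp add: Aut_def homeo_group_def)

lemma mult_Aut:
  "f \<in> carrier (Aut X) \<Longrightarrow> g \<in> carrier (Aut X) \<Longrightarrow> f \<otimes>\<^bsub>Aut X\<^esub> g = compose X f g"
  unfolding Aut_def by (simp add: mult_homeo_group)

lemma group_Aut: "group (Aut X)"
  unfolding Aut_def by (rule group_homeo_group)

text \<open>Membership of \<open>n\<close> in the image is decided at the single point that is mapped to \<open>n\<close>.\<close>

lemma continuous_affine_action:
  assumes "invertible (snd a)"
  shows "continuous_map (subtopology local_topology admissible_sets)
           (subtopology local_topology admissible_sets) (affine_action a)"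
proof (rule continuous_map_localI)
  show "affine_action a U \<in> admissible_sets" if "U \<in> admissible_sets" for U
    using that admissible_affine_action[OF assms] by simp
  fix n
  obtain t M where a: "a = (t, M)" by (cases a)
  then obtain N where N: "M ** N = mat 1" "N ** M = mat 1" using assms by (auto simp: invertible_def)
  have "n \<in> affine_action a U \<longleftrightarrow> N *v (n - t) \<in> U" for U
  proof
    assume "n \<in> affine_action a U"
    then obtain u where "u \<in> U" "n = M *v u + t" by (auto simp: affine_action_def a)
    then show "N *v (n - t) \<in> U" by (simp add: matrix_vector_mul_assoc N)
  next
    assume "N *v (n - t) \<in> U"
    moreover have "n = M *v (N *v (n - t)) + t" by (simp add: matrix_vector_mul_assoc N)
    ultimately show "n \<in> affine_action a U" unfolding affine_action_def a by auto
  qed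
  then show "\<exists>F. finite F \<and> (\<forall>U\<in>admissible_sets. \<forall>W\<in>admissible_sets.
      W \<inter> F = U \<inter> F \<longrightarrow> (n \<in> affine_action a W) = (n \<in> affine_action a U))"
    by (intro exI[of _ "{N *v (n - t)}"]) auto
qed

lemma affine_action_in_Aut:
  assumes "invertible (snd a)"
  shows "restrict (affine_action a) admissible_sets \<in> carrier (Aut admissible_sets)"
proof -
  obtain b where b: "invertible (snd b)" "a \<otimes>\<^bsub>affine_lattice_group\<^esub> b = (0, mat 1)"
    "b \<otimes>\<^bsub>affine_lattice_group\<^esub> a = (0, mat 1)" using affine_inverse[OF assms] by blast
  have "homeomorphic_maps (subtopology local_topology admissible_sets)
      (subtopology local_topology admissible_sets) (affine_action a) (affine_action b)"
    using continuous_affine_action[OF assms] continuous_affine_action[OF b(1)]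
    by (simp add: homeomorphic_maps_def affine_action_mult b affine_action_one)
  then have "homeomorphic_map (subtopology local_topology admissible_sets)
      (subtopology local_topology admissible_sets) (affine_action a)"
    by (rule homeomorphic_maps_imp_map)
  then have "homeomorphic_map (subtopology local_topology admissible_sets)
      (subtopology local_topology admissible_sets) (restrict (affine_action a) admissible_sets)"
    by (rule homeomorphic_map_eq) simp
  then show ?thesis by (simp add: carrier_Aut)
qed

lemma affine_action_mult_Aut:
  assumes "invertible (snd a)" "invertible (snd b)"
  shows "restrict (affine_action a) admissible_sets \<otimes>\<^bsub>Aut admissible_sets\<^esub>
      restrict (affine_action b) admissible_sets
    = restrict (affine_action (a \<otimes>\<^bsub>affine_lattice_group\<^esub> b)) admissible_sets"
  unfolding mult_Aut[OF affine_action_in_Aut[OF assms(1)] affine_action_in_Aut[OF assms(2)]]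
  using admissible_affine_action[OF assms(2)]
  by (auto simp: compose_def fun_eq_iff affine_action_mult)

text \<open>The singletons are admissible, and an affine map is determined by its values on them.\<close>

lemma inj_affine_action:
  "inj_on (\<lambda>a. restrict (affine_action a) admissible_sets) (carrier affine_lattice_group)"
proof (rule inj_onI)
  fix a b :: "(int ^ 'd) \<times> (int ^ 'd ^ 'd)"
  assume eq: "restrict (affine_action a) admissible_sets = restrict (affine_action b) admissible_sets"
  obtain t M s N where ab: "a = (t, M)" "b = (s, N)" by (cases a, cases b)
  have eq_n: "M *v n + t = N *v n + s" for n
  proof -
    have "affine_action a {n} = affine_action b {n}"
      using fun_cong[OF eq, of "{n}"] by (simp add: admissible_singleton)
    then show ?thesis by (simp add: affine_action_def ab)
  qed
  have "t = s" using eq_n[of 0] by simp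
  then show "a = b" using eq_n ab matrix_eq[of M N] by simp
qed

lemma shift_on_eq: "shift_on X t = restrict (affine_action (- t, mat 1)) X"
  by (simp add: shift_on_def shift_eq_affine_action)

lemma invertible_mat_1: "invertible (mat 1)"
  by (auto simp: invertible_def intro: exI[of _ "mat 1"])

lemma shift_on_in_Aut: "shift_on admissible_sets t \<in> carrier (Aut admissible_sets)"
  unfolding shift_on_eq by (rule affine_action_in_Aut) (simp add: invertible_mat_1)

lemma inj_shift_on: "inj (shift_on admissible_sets)"
proof (rule injI)
  fix s t assume "shift_on admissible_sets s = shift_on admissible_sets t"
  then have "(- s, mat 1) = (- t, mat 1 :: int ^ 'a ^ 'a)"
    unfolding shift_on_eq
    using inj_onD[OF inj_affine_action, of "(- s, mat 1)" "(- t, mat 1)"]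
    by (simp add: affine_lattice_group_def invertible_mat_1)
  then show "s = t" by simp
qed

lemma shift_on_iso:
  "shift_on admissible_sets \<in> iso lattice_group (Aut admissible_sets \<lparr>carrier := shifts admissible_sets\<rparr>)"
proof -
  have "shift_on admissible_sets (s + t) = shift_on admissible_sets s \<otimes>\<^bsub>Aut admissible_sets\<^esub> shift_on admissible_sets t"
    for s t :: "int ^ 'a"
  proof -
    have "(- (s + t), mat 1) = (- s, mat 1) \<otimes>\<^bsub>affine_lattice_group\<^esub> (- t, mat 1 :: int ^ 'a ^ 'a)"
      by (simp add: affine_lattice_group_def)
    then show ?thesis
      unfolding shift_on_eq by (simp only:) (rule affine_action_mult_Aut[symmetric], simp_all add: invertible_mat_1)
  qed
  then show ?thesis
    using inj_shift_on by (auto simp: iso_def hom_def lattice_group_def shifts_def bij_betw_def)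
qed

section \<open>Centraliser and normaliser\<close>

lemma commutation_iff:
  assumes "H \<in> carrier (Aut admissible_sets)"
  shows "H \<otimes>\<^bsub>Aut admissible_sets\<^esub> shift_on admissible_sets t
      = shift_on admissible_sets s \<otimes>\<^bsub>Aut admissible_sets\<^esub> H \<longleftrightarrow>
    (\<forall>U. admissible U \<longrightarrow> H (shift t U) = shift s (H U))"
proof -
  have "H U \<in> admissible_sets" if "U \<in> admissible_sets" for U
    using assms that by (auto simp: carrier_Aut homeomorphic_map_maps homeomorphic_maps_def continuous_map_def Pi_iff)
  then show ?thesis
    unfolding mult_Aut[OF assms shift_on_in_Aut] mult_Aut[OF shift_on_in_Aut assms]
    by (auto simp: compose_def fun_eq_iff shift_on_def)
qed

lemma block_code_of_continuous_map:
  fixes H :: "(int ^ 'd) set \<Rightarrow> (int ^ 'd) set"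
  assumes "continuous_map (subtopology local_topology admissible_sets)
      (subtopology local_topology admissible_sets) H"
    and "\<And>U t. admissible U \<Longrightarrow> H (shift t U) = shift t (H U)"
  obtains F where "block_code H F"
proof -
  obtain F where F: "finite F"
    "\<And>U W. U \<in> admissible_sets \<Longrightarrow> W \<in> admissible_sets \<Longrightarrow> W \<inter> F = U \<inter> F \<Longrightarrow> 0 \<in> H W \<longleftrightarrow> 0 \<in> H U"
    using continuous_map_local_window[OF closedin_admissible assms(1), of 0] by metis
  have "admissible (H U)" if "admissible U" for U
    using assms(1) that by (auto simp: continuous_map_def Pi_iff)
  moreover have "0 \<in> H W \<longleftrightarrow> 0 \<in> H U" if "admissible U" "admissible W" "W \<inter> F = U \<inter> F" for U W
    using that by (intro F(2)) simp_all
  ultimately have "block_code H F" using F(1) assms(2) by (intro block_code.intro)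
  then show ?thesis by (rule that)
qed

text \<open>The map and its inverse are both continuous and equivariant, hence mutually inverse block codes.\<close>

lemma commuting_homeomorphism_is_shift:
  assumes H: "H \<in> carrier (Aut admissible_sets)"
    and comm: "\<And>U t. admissible U \<Longrightarrow> H (shift t U) = shift t (H U)"
  shows "\<exists>e. H = shift_on admissible_sets e"
proof -
  obtain G where G: "homeomorphic_maps (subtopology local_topology admissible_sets)
      (subtopology local_topology admissible_sets) H G"
    using H by (auto simp: carrier_Aut homeomorphic_map_maps)
  have cont: "continuous_map (subtopology local_topology admissible_sets)
      (subtopology local_topology admissible_sets) H"
    "continuous_map (subtopology local_topology admissible_sets)
      (subtopology local_topology admissible_sets) G"
    and GH: "\<And>U. admissible U \<Longrightarrow> G (H U) = U" and HG: "\<And>U. admissible U \<Longrightarrow> H (G U) = U"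
    using G by (simp_all add: homeomorphic_maps_def)
  have admG: "admissible (G U)" if "admissible U" for U
    using cont(2) that by (auto simp: continuous_map_def Pi_iff)
  have "G (shift t U) = shift t (G U)" if U: "admissible U" for U t
  proof -
    have "shift t U = H (shift t (G U))" using comm[OF admG[OF U]] HG[OF U] by simp
    then show ?thesis using GH admissible_shift[OF admG[OF U]] by simp
  qed
  then obtain F F' where "block_code H F" "block_code G F'"
    using block_code_of_continuous_map[OF cont(1) comm] block_code_of_continuous_map[OF cont(2)] by metis
  then obtain e where "\<And>U. admissible U \<Longrightarrow> H U = shift e U"
    using invertible_block_code_is_shift GH by metis
  moreover have "H \<in> extensional admissible_sets" using H by (simp add: carrier_Aut)
  ultimately have "H = shift_on admissible_sets e"
    unfolding shift_on_def by (intro extensionalityI[where A = admissible_sets]) auto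
  then show ?thesis ..
qed

lemma symmetry_group_admissible: "symmetry_group admissible_sets = shifts admissible_sets"
proof
  show "symmetry_group admissible_sets \<subseteq> shifts admissible_sets"
  proof
    fix H assume "H \<in> symmetry_group admissible_sets"
    then have H: "H \<in> carrier (Aut admissible_sets)"
      and "\<And>t. H \<otimes>\<^bsub>Aut admissible_sets\<^esub> shift_on admissible_sets t
        = shift_on admissible_sets t \<otimes>\<^bsub>Aut admissible_sets\<^esub> H"
      by (auto simp: symmetry_group_def shifts_def)
    then show "H \<in> shifts admissible_sets"
      using commuting_homeomorphism_is_shift[OF H] commutation_iff[OF H] by (auto simp: shifts_def)
  qed
  have "shift s (shift t U) = shift t (shift s U)" for s t and U :: "(int ^ 'a) set"
    by (auto simp: mem_shift_iff ac_simps)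
  then have "shift_on admissible_sets t \<otimes>\<^bsub>Aut admissible_sets\<^esub> shift_on admissible_sets s
      = shift_on admissible_sets s \<otimes>\<^bsub>Aut admissible_sets\<^esub> shift_on admissible_sets t"
    for s t :: "int ^ 'a"
    unfolding commutation_iff[OF shift_on_in_Aut] by (simp add: shift_on_def admissible_shift)
  then show "shifts admissible_sets \<subseteq> symmetry_group (admissible_sets :: (int ^ 'a) set set)"
    unfolding symmetry_group_def shifts_def using shift_on_in_Aut by blast
qed

text \<open>The equality of the set of conjugates with the set of shifts splits into two inclusions, which are
  the two quantified conditions.\<close>

lemma extended_symmetry_iff:
  "H \<in> extended_symmetry_group admissible_sets \<longleftrightarrow> H \<in> carrier (Aut admissible_sets) \<and>
    (\<forall>t. \<exists>s. \<forall>U. admissible U \<longrightarrow> H (shift t U) = shift s (H U)) \<and>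
    (\<forall>s. \<exists>t. \<forall>U. admissible U \<longrightarrow> H (shift t U) = shift s (H U))"
proof (cases "H \<in> carrier (Aut admissible_sets)")
  case True
  interpret G: group "Aut admissible_sets" by (rule group_Aut)
  let ?G = "Aut admissible_sets" and ?T = "shift_on admissible_sets"
  have conj: "?T s = H \<otimes>\<^bsub>?G\<^esub> ?T t \<otimes>\<^bsub>?G\<^esub> inv\<^bsub>?G\<^esub> H \<longleftrightarrow>
      (\<forall>U. admissible U \<longrightarrow> H (shift t U) = shift s (H U))" for s t
  proof -
    have "?T s = H \<otimes>\<^bsub>?G\<^esub> ?T t \<otimes>\<^bsub>?G\<^esub> inv\<^bsub>?G\<^esub> H \<longleftrightarrow> H \<otimes>\<^bsub>?G\<^esub> ?T t = ?T s \<otimes>\<^bsub>?G\<^esub> H"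
      by (rule G.inv_solve_right[OF shift_on_in_Aut G.m_closed[OF True shift_on_in_Aut] True])
    then show ?thesis unfolding commutation_iff[OF True] .
  qed
  have "shifts admissible_sets \<subseteq> carrier ?G" using shift_on_in_Aut by (auto simp: shifts_def)
  then have "H \<in> extended_symmetry_group admissible_sets \<longleftrightarrow>
      H <#\<^bsub>?G\<^esub> shifts admissible_sets #>\<^bsub>?G\<^esub> inv\<^bsub>?G\<^esub> H = shifts admissible_sets"
    using True extended_symmetry_group_altdef by blast
  moreover have "H <#\<^bsub>?G\<^esub> shifts admissible_sets #>\<^bsub>?G\<^esub> inv\<^bsub>?G\<^esub> H
      = range (\<lambda>t. H \<otimes>\<^bsub>?G\<^esub> ?T t \<otimes>\<^bsub>?G\<^esub> inv\<^bsub>?G\<^esub> H)"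
    by (auto simp: l_coset_def r_coset_def shifts_def)
  ultimately have "H \<in> extended_symmetry_group admissible_sets \<longleftrightarrow>
      range (\<lambda>t. H \<otimes>\<^bsub>?G\<^esub> ?T t \<otimes>\<^bsub>?G\<^esub> inv\<^bsub>?G\<^esub> H) = range ?T"
    by (simp add: shifts_def)
  also have "\<dots> \<longleftrightarrow> (\<forall>t. \<exists>s. ?T s = H \<otimes>\<^bsub>?G\<^esub> ?T t \<otimes>\<^bsub>?G\<^esub> inv\<^bsub>?G\<^esub> H) \<and>
      (\<forall>s. \<exists>t. ?T s = H \<otimes>\<^bsub>?G\<^esub> ?T t \<otimes>\<^bsub>?G\<^esub> inv\<^bsub>?G\<^esub> H)"
    unfolding set_eq_subset image_subset_iff by (auto simp: image_iff) metis+
  finally show ?thesis unfolding conj using True by simp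
next
  case False
  then show ?thesis by (simp add: extended_symmetry_group_def normalizer_def stabilizer_def)
qed

text \<open>Additive maps are linear over the integers, so their values on the unit vectors give the matrix.\<close>

lemma additive_int_matrix:
  fixes \<phi> :: "int ^ 'd \<Rightarrow> int ^ 'd"
  assumes add: "\<And>s t. \<phi> (s + t) = \<phi> s + \<phi> t"
  shows "\<exists>M :: int ^ 'd ^ 'd. \<forall>n. \<phi> n = M *v n"
proof -
  have zero: "\<phi> 0 = 0" using add[of 0 0] by simp
  have minus: "\<phi> (- t) = - \<phi> t" for t using add[of t "- t"] zero by (simp add: eq_neg_iff_add_eq_0 add.commute)
  have nat: "\<phi> (int k *s v) = int k *s \<phi> v" for k v
    by (induction k) (simp_all add: zero add vec.scale_left_distrib)
  have int: "\<phi> (k *s v) = k *s \<phi> v" for k v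
  proof (cases "k \<ge> 0")
    case True
    then show ?thesis using nat[of "nat k" v] by simp
  next
    case False
    then have "\<phi> ((- k) *s v) = (- k) *s \<phi> v" using nat[of "nat (- k)" v] by simp
    moreover have "k *s w = - ((- k) *s w)" for w :: "int ^ 'd" by (simp add: vec_eq_iff)
    ultimately show ?thesis using minus by metis
  qed
  have sum: "\<phi> (\<Sum>j\<in>S. f j) = (\<Sum>j\<in>S. \<phi> (f j))" if "finite S" for S :: "'d set" and f
    using that by (induction S) (simp_all add: zero add)
  define M where "M = (\<chi> i j. \<phi> (axis j 1) $ i)"
  have "\<phi> n = M *v n" for n
  proof -
    have "n = (\<Sum>j\<in>UNIV. n $ j *s axis j 1)"
      by (simp add: vec_eq_iff axis_def if_distrib[of "\<lambda>x. _ * x"] cong: if_cong)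
    then have "\<phi> n = (\<Sum>j\<in>UNIV. n $ j *s \<phi> (axis j 1))" using sum int by (metis (no_types, lifting) finite sum.cong)
    then show ?thesis by (simp add: M_def vec_eq_iff matrix_vector_mult_def mult.commute)
  qed
  then show ?thesis by blast
qed

lemma shift_shift: "shift s (shift t U) = shift (s + t) U"
  by (auto simp: mem_shift_iff ac_simps)

lemma shift_singleton: "shift s {n} = {n - s}"
  by (simp add: shift_def)

lemma affine_action_shift: "affine_action (0, M) (shift t U) = shift (M *v t) (affine_action (0, M) U)"
  unfolding shift_eq_affine_action affine_action_mult
  by (simp add: affine_lattice_group_def matrix_vector_mult_minus)

text \<open>Conjugation by \<open>H\<close> permutes the shifts; faithfulness of the action makes the induced permutation
  \<open>\<phi>\<close> of \<open>\<int>\<^sup>d\<close> additive, so it is a matrix \<open>M \<in> GL(d, \<int>)\<close>. Then \<open>M\<^bsup>-1\<^esup> \<circ> H\<close> commutes with all shifts and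
  is itself a shift.\<close>

lemma extended_symmetry_is_affine:
  fixes H :: "(int ^ 'd) set \<Rightarrow> (int ^ 'd) set"
  assumes H: "H \<in> extended_symmetry_group admissible_sets"
  shows "\<exists>a. invertible (snd a) \<and> H = restrict (affine_action a) admissible_sets"
proof -
  have HA: "H \<in> carrier (Aut admissible_sets)" using H by (simp add: extended_symmetry_iff)
  then obtain G where G: "homeomorphic_maps (subtopology local_topology admissible_sets)
      (subtopology local_topology admissible_sets) H G"
    by (auto simp: carrier_Aut homeomorphic_map_maps)
  have GH: "\<And>U. admissible U \<Longrightarrow> G (H U) = U" and HG: "\<And>U. admissible U \<Longrightarrow> H (G U) = U"
    using G by (simp_all add: homeomorphic_maps_def)
  have admG: "admissible (G U)" if "admissible U" for U
    using G that by (auto simp: homeomorphic_maps_def continuous_map_def Pi_iff)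
  have admH: "admissible (H U)" if "admissible U" for U
    using G that by (auto simp: homeomorphic_maps_def continuous_map_def Pi_iff)
  obtain \<phi> where \<phi>: "\<And>t U. admissible U \<Longrightarrow> H (shift t U) = shift (\<phi> t) (H U)"
    using H unfolding extended_symmetry_iff by metis
  obtain \<psi> where \<psi>: "\<And>s U. admissible U \<Longrightarrow> H (shift (\<psi> s) U) = shift s (H U)"
    using H unfolding extended_symmetry_iff by metis
  \<comment> \<open>The image of \<open>P\<close> is \<open>{0}\<close>, whose translates tell all shifts apart.\<close>
  define P where "P = G {0}"
  have P: "admissible P" "H P = {0}" using admG HG admissible_singleton by (auto simp: P_def)
  have \<phi>\<psi>: "\<phi> (\<psi> s) = s" for s
    using \<phi>[OF P(1), of "\<psi> s"] \<psi>[OF P(1), of s] by (simp add: P(2) shift_singleton)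
  have \<psi>\<phi>: "\<psi> (\<phi> t) = t" for t
  proof -
    have "H (shift (\<psi> (\<phi> t)) {0}) = H (shift t {0})"
      using \<phi>[OF admissible_singleton] \<psi>[OF admissible_singleton] by simp
    then have "shift (\<psi> (\<phi> t)) {0} = shift t {0 :: int ^ 'd}"
      using GH admissible_shift[OF admissible_singleton] by metis
    then show ?thesis by (simp add: shift_singleton)
  qed
  have "\<phi> (s + t) = \<phi> s + \<phi> t" for s t
  proof -
    have "shift (\<phi> (s + t)) {0} = H (shift s (shift t P))"
      using \<phi>[OF P(1)] P(2) by (simp add: shift_shift)
    also have "\<dots> = shift (\<phi> s) (shift (\<phi> t) {0})"
      using \<phi>[OF admissible_shift[OF P(1)]] \<phi>[OF P(1)] P(2) by simp
    finally have "- \<phi> (s + t) = - (\<phi> s + \<phi> t)" by (simp add: shift_shift shift_singleton)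
    then show ?thesis by (simp only: neg_equal_iff_equal)
  qed
  then obtain M where M: "\<And>n. \<phi> n = M *v n" using additive_int_matrix by metis
  have "\<psi> (s + t) = \<psi> s + \<psi> t" for s t
    using \<open>\<And>s t. \<phi> (s + t) = \<phi> s + \<phi> t\<close>[of "\<psi> s" "\<psi> t"] \<phi>\<psi> \<psi>\<phi> by metis
  then obtain N where N: "\<And>n. \<psi> n = N *v n" using additive_int_matrix by metis
  have MN: "M ** N = mat 1" "N ** M = mat 1"
    using \<phi>\<psi> \<psi>\<phi> by (simp_all add: matrix_eq M N matrix_vector_mul_assoc)
  then have inv: "invertible M" "invertible N" by (auto simp: invertible_def)
  let ?R = "\<lambda>a. restrict (affine_action a) admissible_sets"
  interpret A: group "Aut admissible_sets" by (rule group_Aut)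
  have R_in: "?R (0, M) \<in> carrier (Aut admissible_sets)" "?R (0, N) \<in> carrier (Aut admissible_sets)"
    using inv by (auto intro: affine_action_in_Aut)
  define K where "K = ?R (0, N) \<otimes>\<^bsub>Aut admissible_sets\<^esub> H"
  have K: "K \<in> carrier (Aut admissible_sets)" using R_in HA by (simp add: K_def)
  have K_app: "K U = affine_action (0, N) (H U)" if "admissible U" for U
    using that admH[OF that] by (simp add: K_def mult_Aut[OF R_in(2) HA] compose_def)
  have "K (shift t U) = shift t (K U)" if U: "admissible U" for U t
    using K_app[OF U] K_app[OF admissible_shift[OF U]] \<phi>[OF U]
    by (simp add: affine_action_shift M matrix_vector_mul_assoc MN)
  then obtain e where e: "K = shift_on admissible_sets e"
    using commuting_homeomorphism_is_shift[OF K] by metis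
  have "?R (0, M) \<otimes>\<^bsub>Aut admissible_sets\<^esub> ?R (0, N) = ?R (0, mat 1)"
    using inv by (subst affine_action_mult_Aut) (auto simp: affine_lattice_group_def MN)
  moreover have "?R (0, mat 1) \<otimes>\<^bsub>Aut admissible_sets\<^esub> H = H"
  proof (rule extensionalityI[where A = admissible_sets])
    have c: "?R (0, mat 1) \<in> carrier (Aut admissible_sets)"
      by (rule affine_action_in_Aut) (simp add: invertible_mat_1)
    show "?R (0, mat 1) \<otimes>\<^bsub>Aut admissible_sets\<^esub> H \<in> extensional admissible_sets"
      using c HA A.m_closed carrier_Aut by blast
    show "H \<in> extensional admissible_sets" using HA carrier_Aut by blast
    show "(?R (0, mat 1) \<otimes>\<^bsub>Aut admissible_sets\<^esub> H) U = H U" if "U \<in> admissible_sets" for U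
      using that admH by (simp add: mult_Aut[OF c HA] compose_def affine_action_one)
  qed
  ultimately have "H = ?R (0, M) \<otimes>\<^bsub>Aut admissible_sets\<^esub> K"
    unfolding K_def using A.m_assoc[OF R_in HA] by simp
  also have "\<dots> = ?R ((0, M) \<otimes>\<^bsub>affine_lattice_group\<^esub> (- e, mat 1))"
    unfolding e shift_on_eq using inv by (intro affine_action_mult_Aut) (simp_all add: invertible_mat_1)
  finally show ?thesis using inv by (auto simp: affine_lattice_group_def)
qed

text \<open>The affine map \<open>(t\<^sub>0, M)\<close> conjugates the shift by \<open>t\<close> to the shift by \<open>M t\<close>.\<close>

lemma affine_is_extended_symmetry:
  assumes "invertible (snd a)"
  shows "restrict (affine_action a) admissible_sets \<in> extended_symmetry_group admissible_sets"
proof -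
  obtain t0 M where a: "a = (t0, M)" by (cases a)
  obtain N where N: "M ** N = mat 1" using assms a by (auto simp: invertible_def)
  have "affine_action a U = shift (- t0) (affine_action (0, M) U)" for U
    by (simp add: a affine_action_def shift_def image_image)
  then have comm: "affine_action a (shift t U) = shift (M *v t) (affine_action a U)" for t U
    by (simp add: affine_action_shift shift_shift add.commute)
  have surj: "\<exists>t. M *v t = s" for s
    by (rule exI[of _ "N *v s"]) (simp add: matrix_vector_mul_assoc N)
  let ?H = "restrict (affine_action a) admissible_sets"
  have H: "?H (shift t U) = shift (M *v t) (?H U)" if "admissible U" for t U
    using that by (simp add: admissible_shift comm)
  show ?thesis
    unfolding extended_symmetry_iff
  proof (intro conjI allI)
    show "?H \<in> carrier (Aut admissible_sets)" using assms by (rule affine_action_in_Aut)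
    show "\<exists>s. \<forall>U. admissible U \<longrightarrow> ?H (shift t U) = shift s (?H U)" for t using H by blast
    show "\<exists>t. \<forall>U. admissible U \<longrightarrow> ?H (shift t U) = shift s (?H U)" for s using H surj[of s] by metis
  qed
qed

lemma affine_action_iso:
  "(\<lambda>a. restrict (affine_action a) admissible_sets)
    \<in> iso affine_lattice_group (Aut admissible_sets \<lparr>carrier := extended_symmetry_group admissible_sets\<rparr>)"
proof -
  have car: "carrier affine_lattice_group = {a :: (int ^ 'd) \<times> (int ^ 'd ^ 'd). invertible (snd a)}"
    by (auto simp: affine_lattice_group_def)
  have "(\<lambda>a. restrict (affine_action a) admissible_sets) ` {a. invertible (snd a)}
      = extended_symmetry_group (admissible_sets :: (int ^ 'd) set set)"
    using extended_symmetry_is_affine affine_is_extended_symmetry by blast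
  then have "bij_betw (\<lambda>a. restrict (affine_action a) admissible_sets) (carrier affine_lattice_group)
      (extended_symmetry_group (admissible_sets :: (int ^ 'd) set set))"
    unfolding bij_betw_def using inj_affine_action by (simp add: car)
  then show ?thesis
    by (auto simp: iso_def hom_def car affine_action_mult_Aut affine_is_extended_symmetry)
qed

section \<open>The Euler product\<close>

text \<open>As an inverse rather than a quotient of powers indexed from \<open>1\<close>: the value at \<open>0\<close> is \<open>0\<close> for positive
  \<open>d\<close>, so sums may range over all natural numbers.\<close>

definition zeta_term :: "nat \<Rightarrow> nat \<Rightarrow> real" where
  "zeta_term d n = inverse (real n ^ d)"

definition sieved_zeta :: "nat \<Rightarrow> nat set \<Rightarrow> real" where
  "sieved_zeta d P = (\<Sum>n. if \<forall>p\<in>P. \<not> p dvd n then zeta_term d n else 0)"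

definition zeta_tail :: "nat \<Rightarrow> nat \<Rightarrow> real" where
  "zeta_tail d K = (\<Sum>n. zeta_term d (n + Suc K))"

text \<open>The reciprocal of a partial Euler product of \<open>\<zeta>(d)\<close>. It is also the density of the points of \<open>\<int>\<^sup>d\<close>
  that avoid one given coset of \<open>p \<int>\<^sup>d\<close> for each \<open>p \<in> P\<close>.\<close>

definition euler_factor :: "nat \<Rightarrow> nat set \<Rightarrow> real" where
  "euler_factor d P = (\<Prod>p\<in>P. 1 - 1 / real p ^ d)"

context
  fixes d :: nat
  assumes d: "d \<ge> 2"
begin

lemma zeta_term_nonneg: "zeta_term d n \<ge> 0"
  by (simp add: zeta_term_def)

lemma zeta_term_0: "zeta_term d 0 = 0"
  using d by (simp add: zeta_term_def)

lemma summable_zeta_term: "summable (zeta_term d)"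
  unfolding zeta_term_def using inverse_power_summable[OF d, where 'a = real] by simp

lemma summable_sieved: "summable (\<lambda>n. if Q n then zeta_term d n else 0)"
  by (rule summable_comparison_test'[OF summable_zeta_term, of 0]) (simp add: zeta_term_nonneg)

lemma zeta_eq: "zeta (real d) = suminf (zeta_term d)"
proof -
  have "zeta (real d) = (\<Sum>n. zeta_term d (Suc n))"
    unfolding zeta_def zeta_term_def by (simp add: powr_realpow inverse_eq_divide)
  also have "\<dots> = suminf (zeta_term d)"
    using suminf_split_head[OF summable_zeta_term] by (simp add: zeta_term_0)
  finally show ?thesis .
qed

text \<open>The terms to be removed are those at \<open>n = q m\<close> with \<open>m\<close> not divisible by any prime in \<open>P\<close>; each of
  them is \<open>q\<^bsup>-d\<^esup>\<close> times the term at \<open>m\<close>.\<close>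

lemma sieved_zeta_insert:
  assumes q: "prime q" "q \<notin> P" and P: "\<And>p. p \<in> P \<Longrightarrow> prime p"
  shows "sieved_zeta d (insert q P) = (1 - 1 / real q ^ d) * sieved_zeta d P"
proof -
  let ?f = "\<lambda>n. if \<forall>p\<in>P. \<not> p dvd n then zeta_term d n else 0"
  let ?g = "\<lambda>n. if q dvd n then ?f n else 0"
  have "?g = (\<lambda>n. if q dvd n \<and> (\<forall>p\<in>P. \<not> p dvd n) then zeta_term d n else 0)" by auto
  then have g: "summable ?g" using summable_sieved by simp
  have "suminf ?g = (\<Sum>m. ?g (q * m))"
    using prime_gt_0_nat[OF q(1)]
    by (intro suminf_mono_reindex[symmetric]) (auto simp: strict_mono_def elim!: dvdE)
  also have "(\<lambda>m. ?g (q * m)) = (\<lambda>m. 1 / real q ^ d * ?f m)"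
  proof
    fix m
    have "p dvd q * m \<longleftrightarrow> p dvd m" if "p \<in> P" for p
      using that q P[OF that] by (metis prime_dvd_mult_iff primes_dvd_imp_eq)
    then show "?g (q * m) = 1 / real q ^ d * ?f m"
      by (simp add: zeta_term_def power_mult_distrib inverse_eq_divide)
  qed
  also have "suminf \<dots> = 1 / real q ^ d * sieved_zeta d P"
    unfolding sieved_zeta_def by (rule suminf_mult[OF summable_sieved])
  finally have g_sum: "suminf ?g = 1 / real q ^ d * sieved_zeta d P" .
  have "sieved_zeta d (insert q P) = (\<Sum>n. ?f n - ?g n)"
    unfolding sieved_zeta_def by (rule arg_cong[of _ _ suminf]) auto
  also have "\<dots> = suminf ?f - suminf ?g"
    by (rule suminf_diff[symmetric, OF summable_sieved g])
  finally show ?thesis unfolding g_sum by (simp add: sieved_zeta_def algebra_simps)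
qed

lemma sieved_zeta_eq:
  assumes "finite P" "\<And>p. p \<in> P \<Longrightarrow> prime p"
  shows "sieved_zeta d P = zeta (real d) * euler_factor d P"
  using assms
proof (induction P)
  case empty
  then show ?case by (simp add: sieved_zeta_def euler_factor_def zeta_eq)
next
  case (insert q P)
  then show ?case using sieved_zeta_insert[of q P] by (simp add: euler_factor_def)
qed

lemma zeta_pos: "zeta (real d) > 0"
  unfolding zeta_eq by (rule suminf_pos2[OF summable_zeta_term zeta_term_nonneg, of 1]) (simp add: zeta_term_def)

lemma zeta_tail_tendsto: "zeta_tail d \<longlonglongrightarrow> 0"
proof -
  have "(\<lambda>K. suminf (zeta_term d) - (\<Sum>n<Suc K. zeta_term d n)) \<longlonglongrightarrow> suminf (zeta_term d) - suminf (zeta_term d)"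
    by (intro tendsto_intros LIMSEQ_Suc summable_LIMSEQ summable_zeta_term)
  moreover have "zeta_tail d = (\<lambda>K. suminf (zeta_term d) - (\<Sum>n<Suc K. zeta_term d n))"
    unfolding zeta_tail_def by (rule ext) (rule suminf_minus_initial_segment[OF summable_zeta_term])
  ultimately show ?thesis by simp
qed

text \<open>The numbers with all prime factors beyond \<open>K\<close> are \<open>1\<close> and some numbers beyond \<open>K\<close>.\<close>

lemma sieved_zeta_bounds:
  "1 \<le> sieved_zeta d {p. prime p \<and> p \<le> K}" "sieved_zeta d {p. prime p \<and> p \<le> K} \<le> 1 + zeta_tail d K"
proof -
  let ?f = "\<lambda>n. if \<forall>p\<in>{p. prime p \<and> p \<le> K}. \<not> p dvd n then zeta_term d n else 0"
  have one: "?f 1 = 1" by (auto simp: zeta_term_def)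
  have "sum ?f {1} \<le> suminf ?f"
    by (rule sum_le_suminf[OF summable_sieved]) (auto simp: zeta_term_nonneg)
  then show "1 \<le> sieved_zeta d {p. prime p \<and> p \<le> K}" using one by (simp add: sieved_zeta_def)
  have small: "?f n = 0" if n: "n < Suc K" "n \<noteq> 1" for n
  proof (cases "n = 0")
    case False
    obtain p where p: "prime p" "p dvd n" using prime_factor_nat[OF n(2)] by blast
    then have "p \<le> K" using dvd_imp_le[OF p(2)] n False by simp
    then show ?thesis using p by auto
  qed (simp add: zeta_term_0)
  have "suminf ?f = (\<Sum>n. ?f (n + Suc K)) + sum ?f {..<Suc K}"
    by (rule suminf_split_initial_segment[OF summable_sieved])
  also have "(\<Sum>n. ?f (n + Suc K)) \<le> zeta_tail d K"
    unfolding zeta_tail_def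
  proof (rule suminf_le)
    show "?f (n + Suc K) \<le> zeta_term d (n + Suc K)" for n by (simp add: zeta_term_nonneg)
    show "summable (\<lambda>n. ?f (n + Suc K))" using summable_sieved by (rule summable_ignore_initial_segment)
    show "summable (\<lambda>n. zeta_term d (n + Suc K))" using summable_zeta_term by (rule summable_ignore_initial_segment)
  qed
  also have "sum ?f {..<Suc K} \<le> 1"
  proof -
    have "sum ?f {..<Suc K} = sum ?f ({..<Suc K} \<inter> {1})"
      using small by (intro sum.mono_neutral_right) auto
    also have "\<dots> \<le> sum ?f {1}"
      by (intro sum_mono2) (auto simp: zeta_term_nonneg)
    also have "\<dots> = 1" using one by simp
    finally show ?thesis .
  qed
  finally show "sieved_zeta d {p. prime p \<and> p \<le> K} \<le> 1 + zeta_tail d K"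
    by (simp add: sieved_zeta_def)
qed

lemma euler_factor_bounds:
  "1 / zeta (real d) \<le> euler_factor d {p. prime p \<and> p \<le> K}"
  "euler_factor d {p. prime p \<and> p \<le> K} \<le> (1 + zeta_tail d K) / zeta (real d)"
proof -
  have "sieved_zeta d {p. prime p \<and> p \<le> K} = zeta (real d) * euler_factor d {p. prime p \<and> p \<le> K}"
    by (rule sieved_zeta_eq) auto
  then show "1 / zeta (real d) \<le> euler_factor d {p. prime p \<and> p \<le> K}"
    "euler_factor d {p. prime p \<and> p \<le> K} \<le> (1 + zeta_tail d K) / zeta (real d)"
    using sieved_zeta_bounds[of K] zeta_pos by (simp_all only: pos_divide_le_eq pos_le_divide_eq mult.commute)
qed

end

section \<open>Counting sieved points in a cube\<close>

definition sieved_cube :: "nat \<Rightarrow> nat set \<Rightarrow> (nat \<Rightarrow> int ^ 'd) \<Rightarrow> (int ^ 'd) set" where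
  "sieved_cube N P c = {n \<in> cube N. \<forall>p\<in>P. \<not> vcong (int p) n (c p)}"

lemma card_bij_preimage:
  assumes "bij_betw f A B" "C \<subseteq> B" shows "card {x \<in> A. f x \<in> C} = card C"
proof -
  have "f ` {x \<in> A. f x \<in> C} = C" using assms by (auto simp: bij_betw_def)
  moreover have "inj_on f {x \<in> A. f x \<in> C}"
    using assms by (auto simp: bij_betw_def intro: inj_on_subset)
  ultimately show ?thesis by (metis card_image)
qed

text \<open>Injectivity is the uniqueness half of the Chinese remainder theorem; both sides have \<open>(a b)\<^sup>d\<close> elements.\<close>

lemma bij_betw_cube_crt:
  assumes "coprime a b" "a > 0" "b > 0"
  shows "bij_betw (\<lambda>n :: int ^ 'd. (vmod (int a) n, vmod (int b) n)) (cube (a * b)) (cube a \<times> cube b)"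
proof -
  let ?f = "\<lambda>n :: int ^ 'd. (vmod (int a) n, vmod (int b) n)"
  have inj: "inj_on ?f (cube (a * b))"
  proof (rule inj_onI)
    fix x y :: "int ^ 'd" assume xy: "x \<in> cube (a * b)" "y \<in> cube (a * b)" "?f x = ?f y"
    then have "vcong (int a) x y" "vcong (int b) x y" by (simp_all add: vcong_iff_vmod)
    then have "vcong (int (a * b)) x y"
      using assms(1) by (auto simp: vcong_def intro: divides_mult)
    then show "x = y" using xy(1,2) vmod_cube[of _ "a * b"] by (metis vcong_iff_vmod)
  qed
  moreover have "?f ` cube (a * b) = cube a \<times> cube b"
  proof (rule card_seteq)
    show "?f ` cube (a * b) \<subseteq> cube a \<times> cube b" using assms by (auto intro: vmod_in_cube)
    show "card (cube a \<times> cube b :: ((int ^ 'd) \<times> (int ^ 'd)) set) \<le> card (?f ` cube (a * b))"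
      by (simp add: card_image[OF inj] card_cube card_cartesian_product power_mult_distrib)
  qed simp
  ultimately show ?thesis by (simp add: bij_betw_def)
qed

lemma vcong_vmod_dvd: "k dvd m \<Longrightarrow> vcong k (vmod m x) y \<longleftrightarrow> vcong k x y"
  using vcong_dvd[OF vcong_vmod[of m x]] vcong_sym vcong_trans by metis

text \<open>By the Chinese remainder theorem the conditions modulo the primes in \<open>P\<close> are independent on a cube
  whose side is the product of these primes, and each prime excludes one class out of \<open>p\<^sup>d\<close>.\<close>

lemma card_sieved_cube_period:
  fixes c :: "nat \<Rightarrow> int ^ 'd"
  assumes "finite P" "\<And>p. p \<in> P \<Longrightarrow> prime p"
  shows "card (sieved_cube (\<Prod>P) P c) = (\<Prod>p\<in>P. p ^ CARD('d) - 1)"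
  using assms
proof (induction P)
  case empty
  have "sieved_cube 1 {} c = cube 1" by (simp add: sieved_cube_def)
  then show ?case by (simp add: card_cube)
next
  case (insert q P)
  define Q where "Q = \<Prod>P"
  have q: "prime q" and "Q > 0" using insert.prems prime_gt_0_nat by (auto simp: Q_def intro!: prod_pos)
  have "coprime q Q" unfolding Q_def
    using insert by (intro prod_coprime_right) (metis insertCI primes_coprime)
  let ?f = "\<lambda>n :: int ^ 'd. (vmod (int q) n, vmod (int Q) n)"
  let ?B = "(cube q - {vmod (int q) (c q)}) \<times> sieved_cube Q P c"
  have bij: "bij_betw ?f (cube (q * Q)) (cube q \<times> cube Q)"
    using \<open>coprime q Q\<close> prime_gt_0_nat[OF q] \<open>Q > 0\<close> by (rule bij_betw_cube_crt)
  have "sieved_cube (q * Q) (insert q P) c = {n \<in> cube (q * Q). ?f n \<in> ?B}"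
  proof -
    have "vcong (int p) (vmod (int Q) n) y \<longleftrightarrow> vcong (int p) n y" if "p \<in> P" for p y and n :: "int ^ 'd"
      using that insert.hyps by (intro vcong_vmod_dvd) (simp add: Q_def dvd_prodI)
    moreover have "vmod (int q) n \<in> cube q" "vmod (int Q) n \<in> cube Q" for n :: "int ^ 'd"
      using vmod_in_cube \<open>Q > 0\<close> prime_gt_0_nat[OF q] by blast+
    ultimately show ?thesis
      unfolding sieved_cube_def by (simp add: vcong_iff_vmod[of "int q"] set_eq_iff) 
  qed
  moreover have "?B \<subseteq> cube q \<times> cube Q" by (auto simp: sieved_cube_def)
  ultimately have "card (sieved_cube (q * Q) (insert q P) c) = card ?B"
    using card_bij_preimage[OF bij, of ?B] by (simp only:)
  also have "\<dots> = (q ^ CARD('d) - 1) * card (sieved_cube Q P c)"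
    using vmod_in_cube[OF prime_gt_0_nat[OF q], of "c q"]
    by (simp add: card_cartesian_product card_cube card_Diff_singleton)
  also have "card (sieved_cube Q P c) = (\<Prod>p\<in>P. p ^ CARD('d) - 1)"
    unfolding Q_def using insert by blast
  also have "(q ^ CARD('d) - 1) * \<dots> = (\<Prod>p\<in>insert q P. p ^ CARD('d) - 1)"
    using insert.hyps by simp
  also have "q * Q = \<Prod>(insert q P)" using insert.hyps by (simp add: Q_def)
  finally show ?case .
qed

text \<open>A cube of side \<open>k Q\<close> is tiled by \<open>k\<^sup>d\<close> cubes of side \<open>Q\<close>.\<close>

lemma bij_betw_cube_div_mod:
  assumes "Q > 0"
  shows "bij_betw (\<lambda>n :: int ^ 'd. ((\<chi> i. n $ i div int Q), vmod (int Q) n)) (cube (k * Q)) (cube k \<times> cube Q)"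
proof (rule bij_betw_byWitness[where f' = "\<lambda>(u, v). \<chi> i. int Q * u $ i + v $ i"])
  show "(\<lambda>n :: int ^ 'd. ((\<chi> i. n $ i div int Q), vmod (int Q) n)) ` cube (k * Q) \<subseteq> cube k \<times> cube Q"
  proof clarify
    fix n :: "int ^ 'd" assume n: "n \<in> cube (k * Q)"
    have "n $ i div int Q < int k" for i
    proof -
      have "n $ i < int k * int Q" using n by (simp add: cube_def)
      moreover have "int Q * (n $ i div int Q) + n $ i mod int Q = n $ i" by simp
      moreover have "n $ i mod int Q \<ge> 0" using assms by simp
      ultimately have "int Q * (n $ i div int Q) < int Q * int k" by (simp only: mult.commute[of "int k"])
      then show ?thesis using assms by (simp only: mult_less_cancel_left_pos of_nat_0_less_iff)
    qed
    moreover have "0 \<le> n $ i div int Q" for i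
      using n assms by (simp add: cube_def pos_imp_zdiv_nonneg_iff)
    ultimately show "(\<chi> i. n $ i div int Q) \<in> cube k \<and> vmod (int Q) n \<in> cube Q"
      using vmod_in_cube[OF assms, of n] by (simp add: cube_def)
  qed
  show "(\<lambda>(u, v). \<chi> i. int Q * u $ i + v $ i) ` (cube k \<times> cube Q) \<subseteq> (cube (k * Q) :: (int ^ 'd) set)"
  proof clarify
    fix u v :: "int ^ 'd" assume uv: "u \<in> cube k" "v \<in> cube Q"
    show "(\<chi> i. int Q * u $ i + v $ i) \<in> cube (k * Q)"
      unfolding cube_def
    proof (intro CollectI allI)
      fix i
      have b: "0 \<le> u $ i" "u $ i + 1 \<le> int k" "0 \<le> v $ i" "v $ i < int Q"
        using uv by (simp_all add: cube_def add1_zle_eq)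
      have "int Q * (u $ i + 1) \<le> int Q * int k" using b(2) by (intro mult_left_mono) auto
      then show "0 \<le> (\<chi> i. int Q * u $ i + v $ i) $ i \<and> (\<chi> i. int Q * u $ i + v $ i) $ i < int (k * Q)"
        using b by (simp add: algebra_simps)
    qed
  qed
qed (use assms in \<open>auto simp: vmod_def vec_eq_iff cube_def\<close>)

lemma card_sieved_cube:
  fixes c :: "nat \<Rightarrow> int ^ 'd"
  assumes P: "finite P" "\<And>p. p \<in> P \<Longrightarrow> prime p"
  shows "card (sieved_cube (k * \<Prod>P) P c) = k ^ CARD('d) * (\<Prod>p\<in>P. p ^ CARD('d) - 1)"
proof -
  define Q where "Q = \<Prod>P"
  have "Q > 0" using assms prime_gt_0_nat by (auto simp: Q_def intro!: prod_pos)
  let ?f = "\<lambda>n :: int ^ 'd. ((\<chi> i. n $ i div int Q), vmod (int Q) n)"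
  let ?B = "(cube k :: (int ^ 'd) set) \<times> sieved_cube Q P c"
  have bij: "bij_betw ?f (cube (k * Q)) (cube k \<times> cube Q)"
    using \<open>Q > 0\<close> by (rule bij_betw_cube_div_mod)
  have eq: "sieved_cube (k * Q) P c = {n \<in> cube (k * Q). ?f n \<in> ?B}"
  proof -
    have "vcong (int p) (vmod (int Q) n) y \<longleftrightarrow> vcong (int p) n y" if "p \<in> P" for p y and n :: "int ^ 'd"
      using that P by (intro vcong_vmod_dvd) (simp add: Q_def dvd_prodI)
    moreover have "?f n \<in> cube k \<times> cube Q" if "n \<in> cube (k * Q)" for n using bij that by (rule bij_betw_apply)
    ultimately show ?thesis unfolding sieved_cube_def by (simp add: set_eq_iff mem_Times_iff cong: conj_cong)
  qed
  have sub: "?B \<subseteq> cube k \<times> cube Q" by (auto simp: sieved_cube_def)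
  have "card (sieved_cube (k * Q) P c) = card ?B"
    unfolding eq by (rule card_bij_preimage[OF bij sub])
  then show ?thesis
    using card_sieved_cube_period[OF P, of c] by (simp add: Q_def card_cartesian_product card_cube)
qed

lemma prod_euler_factor:
  assumes P: "finite P" "\<And>p. p \<in> P \<Longrightarrow> prime p"
  shows "real (\<Prod>p\<in>P. p ^ d - 1) = real (\<Prod>P) ^ d * euler_factor d P"
proof -
  have "real (p ^ d - 1) = real p ^ d * (1 - 1 / real p ^ d)" if "p \<in> P" for p
  proof -
    have p: "p > 0" using P that prime_gt_0_nat by blast
    then have "real (p ^ d - 1) = real p ^ d - 1" by (simp add: of_nat_diff Suc_leI)
    then show ?thesis using p by (simp add: right_diff_distrib)
  qed
  then show ?thesis by (simp add: euler_factor_def prod.distrib[symmetric] prod_power_distrib)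
qed

section \<open>Counting patterns\<close>

definition patterns :: "nat \<Rightarrow> (int ^ 'd) set set" where
  "patterns N = (\<lambda>U. U \<inter> cube N) ` admissible_sets"

lemma finite_patterns [simp]: "finite (patterns N)"
  by (rule finite_subset[of _ "Pow (cube N)"]) (auto simp: patterns_def)

text \<open>A pattern is a subset of a sieved cube, for one of the \<open>p\<^sup>d\<close> possible classes for each \<open>p \<in> P\<close>. The
  bound is therefore the number of choices of classes times the number of subsets of a sieved cube.\<close>

lemma card_patterns_le:
  assumes P: "finite P" "\<And>p. p \<in> P \<Longrightarrow> prime p" and N: "N \<le> k * \<Prod>P"
  shows "card (patterns N :: (int ^ 'd) set set)
    \<le> (\<Prod>P) ^ CARD('d) * 2 ^ (k ^ CARD('d) * (\<Prod>p\<in>P. p ^ CARD('d) - 1))"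
proof -
  let ?C = "PiE P (\<lambda>p. cube p :: (int ^ 'd) set)"
  let ?S = "\<lambda>c. sieved_cube (k * \<Prod>P) P c :: (int ^ 'd) set"
  have finC: "finite ?C" using P by (intro finite_PiE) auto
  have finS: "finite (?S c)" for c by (simp add: sieved_cube_def)
  have "patterns N \<subseteq> (\<Union>c\<in>?C. Pow (?S c))"
  proof
    fix \<pi> :: "(int ^ 'd) set" assume "\<pi> \<in> patterns N"
    then obtain U where U: "admissible U" "\<pi> = U \<inter> cube N" by (auto simp: patterns_def)
    then obtain c where c: "\<And>p u. prime p \<Longrightarrow> u \<in> U \<Longrightarrow> \<not> vcong (int p) u (c p)"
      unfolding admissible_iff by metis
    define c' where "c' = (\<lambda>p\<in>P. vmod (int p) (c p))"
    have "c' \<in> ?C" using P(2) prime_gt_0_nat by (auto simp: c'_def intro: vmod_in_cube)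
    moreover have "\<pi> \<subseteq> ?S c'"
    proof
      fix n assume n: "n \<in> \<pi>"
      have "n $ i < int (k * \<Prod>P)" for i
      proof -
        have "n $ i < int N" using n U by (auto simp: cube_def)
        also have "int N \<le> int (k * \<Prod>P)" using N by (rule of_nat_mono)
        finally show ?thesis .
      qed
      then have "n \<in> cube (k * \<Prod>P)" using n U by (auto simp: cube_def)
      moreover have "\<not> vcong (int p) n (c' p)" if p: "p \<in> P" for p
      proof
        assume "vcong (int p) n (c' p)"
        then have "vcong (int p) n (c p)" using p vcong_vmod[of "int p" "c p"]
          by (auto simp: c'_def intro: vcong_trans)
        then show False using c[OF P(2)[OF p]] n U by blast
      qed
      ultimately show "n \<in> ?S c'" by (simp add: sieved_cube_def)
    qed
    ultimately show "\<pi> \<in> (\<Union>c\<in>?C. Pow (?S c))" by blast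
  qed
  then have "card (patterns N :: (int ^ 'd) set set) \<le> card (\<Union>c\<in>?C. Pow (?S c))"
    using finC finS by (intro card_mono) auto
  also have "\<dots> \<le> (\<Sum>c\<in>?C. card (Pow (?S c)))" using finC by (rule card_UN_le)
  also have "\<dots> = (\<Sum>c\<in>?C. 2 ^ (k ^ CARD('d) * (\<Prod>p\<in>P. p ^ CARD('d) - 1)))"
    using finS by (intro sum.cong refl) (simp add: card_Pow card_sieved_cube[OF P])
  also have "\<dots> = (\<Prod>P) ^ CARD('d) * 2 ^ (k ^ CARD('d) * (\<Prod>p\<in>P. p ^ CARD('d) - 1))"
    using P(1) by (simp add: card_PiE card_cube prod_power_distrib)
  finally show ?thesis .
qed

text \<open>Division by \<open>m\<close> maps these points injectively into a cube of side \<open>N div m + 1\<close>, which is at most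
  \<open>2 N / m\<close> as \<open>m \<le> N\<close>.\<close>

lemma card_multiples_in_cube:
  assumes "m > 0" "m \<le> N"
  shows "real (card {n \<in> cube N :: (int ^ 'd) set. vcong (int m) n 0})
    \<le> 2 ^ CARD('d) * real N ^ CARD('d) * zeta_term CARD('d) m"
proof -
  let ?A = "{n \<in> cube N :: (int ^ 'd) set. vcong (int m) n 0}"
  let ?f = "\<lambda>n :: int ^ 'd. \<chi> i. n $ i div int m"
  have "inj_on ?f ?A"
  proof (rule inj_onI)
    fix x y assume xy: "x \<in> ?A" "y \<in> ?A" "?f x = ?f y"
    have "x $ i = y $ i" for i
    proof -
      have "x $ i div int m = y $ i div int m" using xy(3) by (simp add: vec_eq_iff)
      moreover have "int m dvd x $ i" "int m dvd y $ i" using xy by (auto simp: vcong_def)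
      ultimately show ?thesis by (metis dvd_mult_div_cancel)
    qed
    then show "x = y" by (simp add: vec_eq_iff)
  qed
  moreover have "?f ` ?A \<subseteq> cube (N div m + 1)"
  proof clarify
    fix n :: "int ^ 'd" assume n: "n \<in> cube N"
    have "n $ i div int m < int (N div m + 1) \<and> 0 \<le> n $ i div int m" for i
    proof -
      have b: "0 \<le> n $ i" "n $ i \<le> int N" using n by (auto simp: cube_def less_imp_le)
      have "n $ i div int m \<le> int N div int m" using b assms by (intro zdiv_mono1) auto
      then show ?thesis using b assms by (simp add: zdiv_int pos_imp_zdiv_nonneg_iff)
    qed
    then show "?f n \<in> cube (N div m + 1)" by (simp add: cube_def)
  qed
  ultimately have "card ?A \<le> card (cube (N div m + 1) :: (int ^ 'd) set)"
    by (intro card_inj_on_le) auto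
  then have "real (card ?A) \<le> real ((N div m + 1) ^ CARD('d))"
    unfolding card_cube by (rule of_nat_mono)
  also have "\<dots> = real (N div m + 1) ^ CARD('d)" by (rule of_nat_power)
  also have "\<dots> \<le> (2 * real N / real m) ^ CARD('d)"
  proof (rule power_mono)
    have "real (N div m) \<le> real N / real m" 
      using assms by (simp add: pos_le_divide_eq flip: of_nat_mult)
    moreover have "1 \<le> real N / real m" using assms by simp
    ultimately show "real (N div m + 1) \<le> 2 * real N / real m" by simp
  qed simp
  also have "\<dots> = 2 ^ CARD('d) * real N ^ CARD('d) * zeta_term CARD('d) m"
    by (simp add: zeta_term_def power_divide power_mult_distrib field_simps)
  finally show ?thesis .
qed

text \<open>A point of the cube that avoids the zero class for all primes up to \<open>K\<close> but is invisible is a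
  nonzero multiple of a prime between \<open>K\<close> and \<open>N\<close>; the number of such points is at most \<open>2\<^sup>d N\<^sup>d\<close>
  times a tail of the zeta series. The lower bound \<open>K \<ge> 2\<close> makes the sieve exclude the origin.\<close>

lemma card_visible_in_cube:
  fixes K k :: nat
  assumes dim: "CARD('d) \<ge> 2" and K: "K \<ge> 2"
  defines "P \<equiv> {p. prime p \<and> p \<le> K}"
  defines "N \<equiv> k * \<Prod>P"
  shows "real (card (visible_points \<inter> cube N :: (int ^ 'd) set))
    \<ge> real N ^ CARD('d) * (1 / zeta (real CARD('d)) - 2 ^ CARD('d) * zeta_tail CARD('d) K)"
proof -
  let ?d = "CARD('d)"
  let ?S = "sieved_cube N P (\<lambda>_. 0) :: (int ^ 'd) set"
  let ?V = "visible_points \<inter> cube N :: (int ^ 'd) set"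
  let ?M = "\<lambda>m. {n \<in> cube N :: (int ^ 'd) set. vcong (int m) n 0}"
  have P: "finite P" "\<And>p. p \<in> P \<Longrightarrow> prime p" by (auto simp: P_def)
  have "?S \<subseteq> ?V \<union> (\<Union>m\<in>{Suc K..N}. ?M m)"
  proof
    fix n assume n: "n \<in> ?S"
    then have nc: "n \<in> cube N" by (simp add: sieved_cube_def)
    show "n \<in> ?V \<union> (\<Union>m\<in>{Suc K..N}. ?M m)"
    proof (cases "n \<in> visible_points")
      case False
      then obtain p :: nat where p: "prime p" "vcong (int p) n 0" unfolding visible_iff by blast
      have "p \<notin> P" using n p by (auto simp: sieved_cube_def)
      then have "K < p" using p by (auto simp: P_def)
      have "2 \<in> P" using K by (simp add: P_def two_is_prime_nat)
      then have "n \<noteq> 0" using n by (auto simp: sieved_cube_def)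
      then obtain i where i: "n $ i \<noteq> 0" by (auto simp: vec_eq_iff)
      then have "int p \<le> n $ i" using p nc
        by (intro zdvd_imp_le) (auto simp: vcong_def cube_def le_neq_trans order_le_less)
      also have "n $ i < int N" using nc by (simp add: cube_def)
      finally have "p \<in> {Suc K..N}" using \<open>K < p\<close> by simp
      then show ?thesis using p nc by blast
    qed (use nc in blast)
  qed
  then have "card ?S \<le> card (?V \<union> (\<Union>m\<in>{Suc K..N}. ?M m))" by (intro card_mono) auto
  also have "\<dots> \<le> card ?V + card (\<Union>m\<in>{Suc K..N}. ?M m)" by (rule card_Un_le)
  also have "card (\<Union>m\<in>{Suc K..N}. ?M m) \<le> (\<Sum>m\<in>{Suc K..N}. card (?M m))" by (rule card_UN_le) simp
  finally have "real (card ?S) \<le> real (card ?V) + (\<Sum>m\<in>{Suc K..N}. real (card (?M m)))"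
    by (simp flip: of_nat_sum of_nat_add)
  also have "(\<Sum>m\<in>{Suc K..N}. real (card (?M m)))
      \<le> (\<Sum>m\<in>{Suc K..N}. 2 ^ ?d * real N ^ ?d * zeta_term ?d m)"
    by (intro sum_mono card_multiples_in_cube) auto
  also have "\<dots> = 2 ^ ?d * real N ^ ?d * (\<Sum>m\<in>{Suc K..N}. zeta_term ?d m)"
    by (simp add: sum_distrib_left)
  also have "(\<Sum>m\<in>{Suc K..N}. zeta_term ?d m) \<le> zeta_tail ?d K"
  proof -
    have "(\<Sum>m\<in>{Suc K..N}. zeta_term ?d m) = (\<Sum>j\<in>(\<lambda>m. m - Suc K) ` {Suc K..N}. zeta_term ?d (j + Suc K))"
      by (subst sum.reindex) (auto simp: inj_on_def)
    also have "\<dots> \<le> zeta_tail ?d K"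
      unfolding zeta_tail_def
    proof (rule sum_le_suminf)
      show "summable (\<lambda>n. zeta_term ?d (n + Suc K))"
        using summable_zeta_term[OF dim] by (rule summable_ignore_initial_segment)
    qed (auto simp: zeta_term_nonneg[OF dim])
    finally show ?thesis .
  qed
  finally have le: "real (card ?S) \<le> real (card ?V) + 2 ^ ?d * real N ^ ?d * zeta_tail ?d K"
    by (simp add: mult_left_mono)
  have "real (card ?S) = real k ^ ?d * real (\<Prod>p\<in>P. p ^ ?d - 1)"
    by (simp only: N_def card_sieved_cube[OF P] of_nat_mult of_nat_power)
  also have "\<dots> = real N ^ ?d * euler_factor ?d P"
    by (simp only: N_def prod_euler_factor[OF P] of_nat_mult power_mult_distrib mult.assoc)
  also have "\<dots> \<ge> real N ^ ?d * (1 / zeta (real ?d))"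
    unfolding P_def by (intro mult_left_mono euler_factor_bounds[OF dim]) simp
  finally show ?thesis using le by (simp add: algebra_simps)
qed

text \<open>Admissibility passes to subsets, so every set of visible points in the cube is a pattern.\<close>

lemma card_patterns_ge:
  "2 ^ card (visible_points \<inter> cube N :: (int ^ 'd) set) \<le> card (patterns N :: (int ^ 'd) set set)"
proof -
  let ?V = "visible_points \<inter> cube N :: (int ^ 'd) set"
  have "Pow ?V \<subseteq> patterns N"
  proof
    fix W assume W: "W \<in> Pow ?V"
    then have "admissible W" using admissible_subset[OF admissible_visible] by blast
    moreover have "W = W \<inter> cube N" using W by blast
    ultimately show "W \<in> patterns N" by (auto simp: patterns_def)
  qed
  then have "card (Pow ?V) \<le> card (patterns N :: (int ^ 'd) set set)" by (intro card_mono) auto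
  moreover have "finite ?V" by simp
  ultimately show ?thesis by (simp only: card_Pow)
qed

section \<open>Open covers and patterns\<close>

abbreviation (input) admissible_space :: "(int ^ 'd) set topology" where
  "admissible_space \<equiv> subtopology local_topology admissible_sets"

text \<open>If \<open>F\<close> is a window for the cover, the pattern of \<open>U\<close> on the sum of \<open>F\<close> and the cube determines, for
  every \<open>t\<close> in the cube, a member of the cover containing the shift of \<open>U\<close> by \<open>t\<close>, hence a member of the
  join containing \<open>U\<close>. That sum fits, after translation, into a cube whose side is larger by a
  constant \<open>L\<close>.\<close>

lemma cover_join_has_small_subcover:
  fixes \<C> :: "(int ^ 'd) set set set"
  assumes "open_cover admissible_space \<C>"
  obtains L where "\<And>N. \<exists>\<D>\<subseteq>cover_join admissible_space shift (cube N) \<C>.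
      finite \<D> \<and> card \<D> \<le> card (patterns (N + L) :: (int ^ 'd) set set) \<and> \<Union>\<D> = admissible_sets"
proof -
  obtain F where F: "finite F" "\<And>U. U \<in> admissible_sets \<Longrightarrow>
      \<exists>C\<in>\<C>. \<forall>W\<in>admissible_sets. W \<inter> F = U \<inter> F \<longrightarrow> W \<in> C"
    using open_cover_window[OF closedin_admissible assms] by metis
  define B where "B U = (SOME C. C \<in> \<C> \<and> (\<forall>W\<in>admissible_sets. W \<inter> F = U \<inter> F \<longrightarrow> W \<in> C))" for U
  have B: "B U \<in> \<C>" "\<And>W. admissible W \<Longrightarrow> W \<inter> F = U \<inter> F \<Longrightarrow> W \<in> B U" if "admissible U" for U
  proof -
    have "\<exists>C. C \<in> \<C> \<and> (\<forall>W\<in>admissible_sets. W \<inter> F = U \<inter> F \<longrightarrow> W \<in> C)"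
      using F(2)[of U] that by auto
    then have "B U \<in> \<C> \<and> (\<forall>W\<in>admissible_sets. W \<inter> F = U \<inter> F \<longrightarrow> W \<in> B U)"
      unfolding B_def by (rule someI_ex)
    then show "B U \<in> \<C>" "\<And>W. admissible W \<Longrightarrow> W \<inter> F = U \<inter> F \<Longrightarrow> W \<in> B U" by simp_all
  qed
  define M where "M = (\<Sum>f\<in>F. \<Sum>i\<in>UNIV. nat \<bar>f $ i\<bar>)"
  have M: "\<bar>f $ i\<bar> \<le> int M" if "f \<in> F" for f i
  proof -
    have "nat \<bar>f $ i\<bar> \<le> (\<Sum>i\<in>UNIV. nat \<bar>f $ i\<bar>)" by (intro member_le_sum) auto
    also have "\<dots> \<le> M" unfolding M_def
      using that F(1) by (intro member_le_sum[of f F "\<lambda>f. \<Sum>i\<in>UNIV. nat \<bar>f $ i\<bar>"]) auto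
    finally show ?thesis by linarith
  qed
  \<comment> \<open>Translation by \<open>v\<close> moves the window into the positive orthant.\<close>
  define v :: "int ^ 'd" where "v = (\<chi> _. int M)"
  define L where "L = 2 * M + 1"
  have "\<exists>\<D>\<subseteq>cover_join admissible_space shift (cube N) \<C>.
      finite \<D> \<and> card \<D> \<le> card (patterns (N + L) :: (int ^ 'd) set set) \<and> \<Union>\<D> = admissible_sets" for N
  proof -
    define \<kappa> where "\<kappa> U = shift (- v) U \<inter> cube (N + L)" for U
    have \<kappa>_pat: "\<kappa> ` admissible_sets \<subseteq> patterns (N + L)"
      using admissible_shift by (auto simp: \<kappa>_def patterns_def)
    \<comment> \<open>A fixed configuration for each pattern, so that there are no more members than patterns.\<close>
    define r where "r \<pi> = (SOME U. admissible U \<and> \<kappa> U = \<pi>)" for \<pi>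
    have r: "admissible (r (\<kappa> U)) \<and> \<kappa> (r (\<kappa> U)) = \<kappa> U" if "admissible U" for U
      unfolding r_def by (rule someI[of "\<lambda>W. admissible W \<and> \<kappa> W = \<kappa> U" U]) (use that in simp)
    define J where "J \<pi> = admissible_sets \<inter> (\<Inter>t\<in>cube N. shift t -` B (shift t (r \<pi>)))" for \<pi>
    let ?D = "J ` \<kappa> ` admissible_sets"
    have "?D \<subseteq> cover_join admissible_space shift (cube N) \<C>"
    proof clarify
      fix U :: "(int ^ 'd) set" assume "admissible U"
      then have "(\<lambda>t. B (shift t (r (\<kappa> U)))) \<in> cube N \<rightarrow> \<C>"
        using r B(1) admissible_shift by blast
      then show "J (\<kappa> U) \<in> cover_join admissible_space shift (cube N) \<C>"
        unfolding cover_join_def J_def by auto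
    qed
    moreover have "finite (\<kappa> ` admissible_sets)" using \<kappa>_pat finite_subset finite_patterns by blast
    then have "finite ?D" "card ?D \<le> card (patterns (N + L) :: (int ^ 'd) set set)"
      using card_image_le[of "\<kappa> ` admissible_sets" J] card_mono[OF finite_patterns \<kappa>_pat] by simp_all
    moreover have "W \<in> J (\<kappa> W)" if W: "admissible W" for W
    proof -
      have "shift t W \<in> B (shift t (r (\<kappa> W)))" if t: "t \<in> cube N" for t
      proof (rule B(2))
        show "admissible (shift t (r (\<kappa> W)))" "admissible (shift t W)"
          using r[OF W] W admissible_shift by blast+
        have "f + t \<in> W \<longleftrightarrow> f + t \<in> r (\<kappa> W)" if f: "f \<in> F" for f
        proof -
          have "f + t + v \<in> cube (N + L)"
            unfolding cube_def
          proof (intro CollectI allI)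
            fix i
            have "0 \<le> t $ i" "t $ i < int N" using t by (auto simp: cube_def)
            then show "0 \<le> (f + t + v) $ i \<and> (f + t + v) $ i < int (N + L)"
              using M[OF f, of i] by (simp add: v_def L_def abs_le_iff)
          qed
          moreover have "\<kappa> (r (\<kappa> W)) = \<kappa> W" using r[OF W] by blast
          ultimately have "f + t + v \<in> shift (- v) W \<longleftrightarrow> f + t + v \<in> shift (- v) (r (\<kappa> W))"
            unfolding \<kappa>_def by blast
          then show ?thesis by (simp add: mem_shift_iff)
        qed
        then show "shift t W \<inter> F = shift t (r (\<kappa> W)) \<inter> F" by (auto simp: mem_shift_iff)
      qed
      then show ?thesis using W by (simp add: J_def)
    qed
    then have "\<Union>?D = admissible_sets" by (auto simp: J_def)
    ultimately show ?thesis by blast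
  qed
  then show ?thesis by (rule that)
qed

lemma min_subcover_le:
  assumes "open_cover admissible_space (\<C> :: (int ^ 'd) set set set)"
  obtains L where "\<And>N. min_subcover admissible_space (cover_join admissible_space shift (cube N) \<C>)
     \<le> card (patterns (N + L) :: (int ^ 'd) set set)"
proof -
  obtain L where L: "\<And>N. \<exists>\<D>\<subseteq>cover_join admissible_space shift (cube N) \<C>.
      finite \<D> \<and> card \<D> \<le> card (patterns (N + L) :: (int ^ 'd) set set) \<and> \<Union>\<D> = admissible_sets"
    using cover_join_has_small_subcover[OF assms] by metis
  have "min_subcover admissible_space (cover_join admissible_space shift (cube N) \<C>)
     \<le> card (patterns (N + L) :: (int ^ 'd) set set)" for N
  proof -
    obtain \<D> where \<D>: "\<D> \<subseteq> cover_join admissible_space shift (cube N) \<C>" "finite \<D>"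
      "card \<D> \<le> card (patterns (N + L) :: (int ^ 'd) set set)" "\<Union>\<D> = admissible_sets"
      using L[of N] by blast
    have "min_subcover admissible_space (cover_join admissible_space shift (cube N) \<C>) \<le> card \<D>"
      unfolding min_subcover_def using \<D> by (intro Least_le exI[of _ \<D>]) simp
    then show ?thesis using \<D>(3) by simp
  qed
  then show ?thesis by (rule that)
qed

definition origin_cover :: "(int ^ 'd) set set set" where
  "origin_cover = {{U \<in> admissible_sets. 0 \<in> U}, {U \<in> admissible_sets. 0 \<notin> U}}"

lemma open_cover_origin: "open_cover admissible_space origin_cover"
proof -
  have eq: "{U \<in> admissible_sets. 0 \<in> U} = {W. W \<inter> {0} = {0} \<inter> {0}} \<inter> (admissible_sets :: (int ^ 'd) set set)"
    "{U \<in> admissible_sets. 0 \<notin> U} = {W. W \<inter> {0} = {} \<inter> {0}} \<inter> (admissible_sets :: (int ^ 'd) set set)"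
    by auto
  have op: "openin admissible_space ({W. W \<inter> {0} = A \<inter> {0}} \<inter> (admissible_sets :: (int ^ 'd) set set))" for A
    unfolding openin_subtopology by (rule exI, rule conjI[OF openin_cylinder refl]) simp
  have "openin admissible_space {U \<in> (admissible_sets :: (int ^ 'd) set set). 0 \<in> U}"
    "openin admissible_space {U \<in> (admissible_sets :: (int ^ 'd) set set). 0 \<notin> U}"
    unfolding eq by (rule op)+
  then have "openin admissible_space C" if "C \<in> origin_cover" for C :: "(int ^ 'd) set set"
    using that unfolding origin_cover_def by blast
  then show ?thesis unfolding open_cover_def by (auto simp: origin_cover_def)
qed

text \<open>All configurations in a member of this join have the same pattern on the cube, so a subcover needs
  a member for each pattern.\<close>

lemma min_subcover_origin_ge:
  "card (patterns N :: (int ^ 'd) set set)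
    \<le> min_subcover admissible_space (cover_join admissible_space shift (cube N) (origin_cover :: (int ^ 'd) set set set))"
proof -
  let ?J = "cover_join admissible_space shift (cube N) (origin_cover :: (int ^ 'd) set set set)"
  have same: "U \<inter> cube N = W \<inter> cube N" if E: "E \<in> ?J" "U \<in> E" "W \<in> E" for E U W
  proof -
    obtain c where c: "c \<in> cube N \<rightarrow> origin_cover" "E = topspace admissible_space \<inter> (\<Inter>t\<in>cube N. shift t -` c t)"
      using E(1) unfolding cover_join_def by blast
    have "t \<in> U \<longleftrightarrow> t \<in> W" if t: "t \<in> cube N" for t
    proof -
      have "shift t U \<in> c t" "shift t W \<in> c t" "c t \<in> origin_cover"
        using E(2,3) t c by auto
      then have "0 \<in> shift t U \<longleftrightarrow> 0 \<in> shift t W" by (auto simp: origin_cover_def)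
      then show ?thesis by (simp add: mem_shift_iff)
    qed
    then show ?thesis by blast
  qed
  have lower: "card (patterns N :: (int ^ 'd) set set) \<le> card \<D>"
    if \<D>: "\<D> \<subseteq> ?J" "finite \<D>" "\<Union>\<D> = admissible_sets" for \<D>
  proof -
    define h where "h E = (SOME U. U \<in> E) \<inter> cube N" for E :: "(int ^ 'd) set set"
    have "patterns N \<subseteq> h ` \<D>"
    proof
      fix \<pi> :: "(int ^ 'd) set" assume "\<pi> \<in> patterns N"
      then obtain U where U: "admissible U" "\<pi> = U \<inter> cube N" by (auto simp: patterns_def)
      then obtain E where E: "E \<in> \<D>" "U \<in> E" using \<D>(3) by blast
      then have "(SOME U. U \<in> E) \<in> E" using someI[of "\<lambda>U. U \<in> E"] by blast
      then have "h E = \<pi>" using same[of E "SOME U. U \<in> E" U] E \<D>(1) U by (auto simp: h_def)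
      then show "\<pi> \<in> h ` \<D>" using E by blast
    qed
    then show ?thesis using \<D>(2) by (rule surj_card_le[rotated])
  qed
  obtain \<D>0 where \<D>0: "\<D>0 \<subseteq> ?J" "finite \<D>0" "\<Union>\<D>0 = admissible_sets"
    using cover_join_has_small_subcover[OF open_cover_origin] by metis
  let ?Q = "\<lambda>k. \<exists>\<D>\<subseteq>?J. finite \<D> \<and> card \<D> = k \<and> \<Union>\<D> = topspace admissible_space"
  have "?Q (card \<D>0)" using \<D>0 by (intro exI[of _ \<D>0]) simp
  then have "?Q (min_subcover admissible_space ?J)" unfolding min_subcover_def by (rule LeastI)
  then obtain \<D> where "\<D> \<subseteq> ?J" "finite \<D>" "card \<D> = min_subcover admissible_space ?J" "\<Union>\<D> = admissible_sets"
    by auto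
  then show ?thesis using lower by metis
qed

section \<open>Entropy\<close>

text \<open>The case \<open>a = 0\<close> is covered by the convention \<open>ln 0 = 0\<close>.\<close>

lemma ln_real_mono: "a \<le> b \<Longrightarrow> b \<ge> 1 \<Longrightarrow> ln (real a) \<le> ln (real b)"
  by (cases "a = 0") auto

lemma ln_card_patterns_le:
  assumes P: "finite P" "\<And>p. p \<in> P \<Longrightarrow> prime p"
  shows "ln (real (card (patterns N :: (int ^ 'd) set set)))
    \<le> real CARD('d) * ln (real (\<Prod>P)) + ln 2 * euler_factor CARD('d) P * real (N + \<Prod>P) ^ CARD('d)"
proof -
  let ?d = "CARD('d)"
  define Q where "Q = \<Prod>P"
  have Q: "Q > 0" using P prime_gt_0_nat by (auto simp: Q_def intro!: prod_pos)
  define k where "k = N div Q + 1"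
  have "N \<le> k * Q"
    using div_mult_mod_eq[of N Q] mod_less_divisor[OF Q, of N]
    unfolding k_def add_mult_distrib by linarith
  have "k * Q \<le> N + Q" by (simp add: k_def)
  have ef: "euler_factor ?d P \<ge> 0"
    unfolding euler_factor_def
  proof (rule prod_nonneg)
    fix p assume "p \<in> P"
    then have "1 \<le> real p" using P(2) prime_ge_1_nat by fastforce
    then show "0 \<le> 1 - 1 / real p ^ ?d" by (simp add: one_le_power divide_le_eq_1)
  qed
  have "card (patterns N :: (int ^ 'd) set set) \<le> Q ^ ?d * 2 ^ (k ^ ?d * (\<Prod>p\<in>P. p ^ ?d - 1))"
    unfolding Q_def using P \<open>N \<le> k * Q\<close> by (intro card_patterns_le) (auto simp: Q_def)
  moreover have "1 \<le> Q ^ ?d * 2 ^ (k ^ ?d * (\<Prod>p\<in>P. p ^ ?d - 1))" using Q by simp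
  ultimately have "ln (real (card (patterns N :: (int ^ 'd) set set)))
      \<le> ln (real (Q ^ ?d * 2 ^ (k ^ ?d * (\<Prod>p\<in>P. p ^ ?d - 1))))"
    by (rule ln_real_mono)
  also have "\<dots> = real ?d * ln (real Q) + real (k ^ ?d * (\<Prod>p\<in>P. p ^ ?d - 1)) * ln 2"
    using Q by (simp only: of_nat_mult of_nat_power of_nat_numeral) (simp add: ln_mult ln_realpow)
  also have "real (k ^ ?d * (\<Prod>p\<in>P. p ^ ?d - 1)) = euler_factor ?d P * real (k * Q) ^ ?d"
    by (simp only: Q_def prod_euler_factor[OF P] of_nat_mult of_nat_power power_mult_distrib ac_simps)
  also have "euler_factor ?d P * real (k * Q) ^ ?d * ln 2 \<le> euler_factor ?d P * real (N + Q) ^ ?d * ln 2"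
    using \<open>k * Q \<le> N + Q\<close> ef by (intro mult_right_mono mult_left_mono power_mono of_nat_mono) auto
  finally show ?thesis by (simp add: Q_def ac_simps)
qed

text \<open>The constants \<open>L\<close> and \<open>\<Prod>P\<close> by which the side of the cube grows are negligible against \<open>N\<close>.\<close>

lemma cover_entropy_le_euler:
  assumes "open_cover admissible_space (\<C> :: (int ^ 'd) set set set)"
    and P: "finite P" "\<And>p. p \<in> P \<Longrightarrow> prime p"
  shows "cover_entropy admissible_space shift \<C> \<le> ereal (ln 2 * euler_factor CARD('d) P)"
proof -
  let ?d = "CARD('d)"
  obtain L where L: "\<And>N. min_subcover admissible_space (cover_join admissible_space shift (cube N) \<C>)
     \<le> card (patterns (N + L) :: (int ^ 'd) set set)"
    using min_subcover_le[OF assms(1)] by metis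
  define c where "c = L + \<Prod>P"
  define a where "a = real ?d * ln (real (\<Prod>P))"
  define e where "e = ln 2 * euler_factor ?d P"
  let ?m = "\<lambda>N. ln (real (min_subcover admissible_space (cover_join admissible_space shift (cube N) \<C>)))
      / real (card (cube N :: (int ^ 'd) set))"
  define b where "b N = a * (1 / real N) ^ ?d + e * ((real N + real c) / real N) ^ ?d" for N
  have m_le: "?m N \<le> b N" for N
  proof -
    have "patterns (N + L) \<noteq> ({} :: (int ^ 'd) set set)"
      using admissible_visible by (auto simp: patterns_def)
    then have "card (patterns (N + L) :: (int ^ 'd) set set) \<ge> 1"
      using finite_patterns by (metis One_nat_def Suc_leI card_gt_0_iff)
    then have "ln (real (min_subcover admissible_space (cover_join admissible_space shift (cube N) \<C>)))
        \<le> ln (real (card (patterns (N + L) :: (int ^ 'd) set set)))"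
      using L by (intro ln_real_mono)
    also have "\<dots> \<le> a + e * real (N + L + \<Prod>P) ^ ?d"
      unfolding a_def e_def by (rule ln_card_patterns_le[OF P])
    also have "N + L + \<Prod>P = N + c" by (simp add: c_def)
    finally have "?m N \<le> (a + e * real (N + c) ^ ?d) / real (card (cube N :: (int ^ 'd) set))"
      by (intro divide_right_mono) auto
    also have "\<dots> = b N"
      unfolding b_def power_divide card_cube of_nat_add of_nat_power
      by (simp only: add_divide_distrib power_one times_divide_eq_right mult_1_right)
    finally show ?thesis .
  qed
  have "(\<lambda>N. (real N + real c) / real N) \<longlonglongrightarrow> 1" by real_asymp
  moreover have "(\<lambda>N. 1 / real N) \<longlonglongrightarrow> 0" by real_asymp
  ultimately have "b \<longlonglongrightarrow> a * 0 ^ ?d + e * 1 ^ ?d"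
    unfolding b_def by (intro tendsto_intros)
  then have "(\<lambda>N. ereal (b N)) \<longlonglongrightarrow> ereal e" by (simp add: card_eq_0_iff power_0_left)
  then have "limsup (\<lambda>N. ereal (b N)) = ereal e" by (simp add: lim_imp_Limsup)
  moreover have "limsup (\<lambda>N. ereal (?m N)) \<le> limsup (\<lambda>N. ereal (b N))"
    using m_le by (intro Limsup_mono always_eventually) simp
  ultimately show ?thesis unfolding cover_entropy_def e_def by simp
qed

lemma cover_entropy_le:
  assumes dim: "CARD('d) \<ge> 2" and "open_cover admissible_space (\<C> :: (int ^ 'd) set set set)"
  shows "cover_entropy admissible_space shift \<C> \<le> ereal (ln 2 / zeta (real CARD('d)))"
proof -
  let ?d = "CARD('d)"
  have "(\<lambda>K. ln 2 * ((1 + zeta_tail ?d K) / zeta (real ?d))) \<longlonglongrightarrow> ln 2 * ((1 + 0) / zeta (real ?d))"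
    using zeta_pos[OF dim] by (intro tendsto_intros zeta_tail_tendsto[OF dim]) auto
  then have "(\<lambda>K. ereal (ln 2 * ((1 + zeta_tail ?d K) / zeta (real ?d)))) \<longlonglongrightarrow> ereal (ln 2 / zeta (real ?d))"
    by simp
  moreover have "cover_entropy admissible_space shift \<C> \<le> ereal (ln 2 * ((1 + zeta_tail ?d K) / zeta (real ?d)))" for K
  proof -
    have "cover_entropy admissible_space shift \<C> \<le> ereal (ln 2 * euler_factor ?d {p. prime p \<and> p \<le> K})"
      by (rule cover_entropy_le_euler[OF assms(2)]) auto
    also have "\<dots> \<le> ereal (ln 2 * ((1 + zeta_tail ?d K) / zeta (real ?d)))"
      unfolding ereal_less_eq by (intro mult_left_mono euler_factor_bounds(2)[OF dim]) simp
    finally show ?thesis .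
  qed
  ultimately show ?thesis by (intro LIMSEQ_le_const) blast+
qed

text \<open>The upper limit is bounded below along the sides that are multiples of the product of the primes up
  to \<open>K\<close>, for which the visible points have been counted; then \<open>K\<close> tends to infinity.\<close>

lemma origin_cover_entropy_ge:
  assumes dim: "CARD('d) \<ge> 2"
  shows "cover_entropy admissible_space shift (origin_cover :: (int ^ 'd) set set set)
    \<ge> ereal (ln 2 / zeta (real CARD('d)))"
proof -
  let ?d = "CARD('d)"
  let ?m = "\<lambda>N. ln (real (min_subcover admissible_space
        (cover_join admissible_space shift (cube N) (origin_cover :: (int ^ 'd) set set set))))
      / real (card (cube N :: (int ^ 'd) set))"
  have lower: "ereal (ln 2 * (1 / zeta (real ?d) - 2 ^ ?d * zeta_tail ?d K))
      \<le> cover_entropy admissible_space shift (origin_cover :: (int ^ 'd) set set set)" if K: "K \<ge> 2" for K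
  proof -
    let ?x = "ln 2 * (1 / zeta (real ?d) - 2 ^ ?d * zeta_tail ?d K)"
    define Q where "Q = \<Prod>{p. prime p \<and> p \<le> K}"
    have Q: "Q > 0" using prime_gt_0_nat by (auto simp: Q_def intro!: prod_pos)
    define r where "r k = Suc k * Q" for k
    have "strict_mono r" using Q by (simp add: r_def strict_mono_def)
    have "?x \<le> ?m (r k)" for k
    proof -
      let ?V = "visible_points \<inter> cube (r k) :: (int ^ 'd) set"
      have c: "real (card (cube (r k) :: (int ^ 'd) set)) = real (r k) ^ ?d" by (simp add: card_cube)
      have "r k > 0" using Q by (simp add: r_def)
      then have pos: "real (r k) ^ ?d > 0" by simp
      have "real (r k) ^ ?d * (1 / zeta (real ?d) - 2 ^ ?d * zeta_tail ?d K) \<le> real (card ?V)"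
        unfolding r_def Q_def by (rule card_visible_in_cube[OF dim K])
      then have "?x * real (r k) ^ ?d \<le> real (card ?V) * ln 2"
        using mult_right_mono[of "real (r k) ^ ?d * (1 / zeta (real ?d) - 2 ^ ?d * zeta_tail ?d K)"
            "real (card ?V)" "ln 2"] by (simp add: mult.commute mult.left_commute)
      also have "\<dots> = ln (real (2 ^ card ?V))" by (simp add: ln_realpow)
      also have "\<dots> \<le> ln (real (min_subcover admissible_space
        (cover_join admissible_space shift (cube (r k)) (origin_cover :: (int ^ 'd) set set set))))"
      proof (rule ln_real_mono)
        show le: "2 ^ card ?V \<le> min_subcover admissible_space
          (cover_join admissible_space shift (cube (r k)) (origin_cover :: (int ^ 'd) set set set))"
          using card_patterns_ge min_subcover_origin_ge by (rule order_trans)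
        show "1 \<le> min_subcover admissible_space
          (cover_join admissible_space shift (cube (r k)) (origin_cover :: (int ^ 'd) set set set))"
          using le by (rule order_trans[rotated]) simp
      qed
      finally show ?thesis unfolding c using pos by (simp add: pos_le_divide_eq)
    qed
    then have "ereal ?x \<le> limsup ((\<lambda>N. ereal (?m N)) \<circ> r)"
      by (intro le_Limsup always_eventually) simp_all
    also have "\<dots> \<le> limsup (\<lambda>N. ereal (?m N))" using \<open>strict_mono r\<close> by (rule limsup_subseq_mono)
    finally show ?thesis unfolding cover_entropy_def .
  qed
  have "(\<lambda>K. ln 2 * (1 / zeta (real ?d) - 2 ^ ?d * zeta_tail ?d K)) \<longlonglongrightarrow> ln 2 * (1 / zeta (real ?d) - 2 ^ ?d * 0)"
    by (intro tendsto_intros zeta_tail_tendsto[OF dim])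
  then have "(\<lambda>K. ereal (ln 2 * (1 / zeta (real ?d) - 2 ^ ?d * zeta_tail ?d K))) \<longlonglongrightarrow> ereal (ln 2 / zeta (real ?d))"
    by simp
  then show ?thesis by (rule LIMSEQ_le_const2) (use lower in blast)
qed

lemma entropy_admissible:
  assumes dim: "CARD('d) \<ge> 2"
  shows "topological_entropy (admissible_space :: (int ^ 'd) set topology) shift
    = ereal (ln 2 / zeta (real CARD('d)))"
  unfolding topological_entropy_def
proof (rule antisym)
  show "(SUP \<C>\<in>{\<C>. open_cover (admissible_space :: (int ^ 'd) set topology) \<C>}.
      cover_entropy admissible_space shift \<C>) \<le> ereal (ln 2 / zeta (real CARD('d)))"
    using cover_entropy_le[OF dim] by (intro SUP_least) simp
  show "ereal (ln 2 / zeta (real CARD('d)))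
      \<le> (SUP \<C>\<in>{\<C>. open_cover (admissible_space :: (int ^ 'd) set topology) \<C>}.
        cover_entropy admissible_space shift \<C>)"
    using origin_cover_entropy_ge[OF dim] open_cover_origin by (intro SUP_upper2) auto
qed

section \<open>The dynamical system of the visible points\<close>

theorem theorem4p1:
  fixes V :: "(int ^ 'd) set" and X :: "(int ^ 'd) set set"
  assumes dim: "CARD('d) \<ge> 2"
    and V: "V = visible_points"
    and X: "X = translation_hull V"
  shows "V = UNIV - (\<Union>p\<in>{p. prime p}. multiples p)
    \<and> topological_entropy (subtopology local_topology X) shift
        = ereal (ln 2 / zeta (real CARD('d)))
    \<and> X = {U. admissible U}
    \<and> symmetry_group X = shifts X
    \<and> shift_on X \<in> iso lattice_group (Aut X \<lparr>carrier := shifts X\<rparr>)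
    \<and> (\<lambda>a. restrict (affine_action a) X)
        \<in> iso affine_lattice_group (Aut X \<lparr>carrier := extended_symmetry_group X\<rparr>)"
proof -
  have X': "X = {U. admissible U}" unfolding X V by (rule translation_hull_visible[OF dim])
  show ?thesis
    unfolding X' V
    by (intro conjI visible_points_eq entropy_admissible[OF dim] refl symmetry_group_admissible
        shift_on_iso affine_action_iso)
qed

end
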